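(* Let $k\ge1$ and let $\Lambda$ be a row-finite $k$-graph without sources, with talented monoid $T_\Lambda$. Then: (i) $\Lambda$ has Condition (HL) if and only if ${}^{\mathbf{n}}a\ne a$ for all $0\ne a\in T_\Lambda$ and $\mathbf{n}\in\mathbb{Z}^k_{<0}$; (ii) $\Lambda$ has Condition (HNE) if and only if there are no $a\in T_\Lambda$ and $\mathbf{q}\in\mathbb{N}^k$ such that ${}^{\mathbf{q}}a<a$. Furthermore, if $|\Lambda^0|<\infty$, then $\Lambda$ has Condition (HNE) if and only if for any $0\ne a\in T_\Lambda$ and $i\in\{1,2,\dots,k\}$ there exists $n_i\in\mathbb{N}\setminus\{0\}$ such that ${}^{n_i\mathbf{e}_i}a=a$.
   Context: $\mathbb{N}=\{0,1,2,\dots\}$; $\mathbb{Z}^k$ has the coordinatewise order; $\mathbf{e}_i$ is the $i$-th unit vector; $\mathbb{Z}^k_{<0}$ is the set of $k$-tuples of nonpositive integers excluding the zero tuple. A $k$-graph is a countable small category $\Lambda$ with a functor $d:\Lambda\to\mathbb{N}^k$ (degree) such that whenever $d(\lambda)=\mathbf{n}+\mathbf{m}$ with $\mathbf{n},\mathbf{m}\in\mathbb{N}^k$ there are unique $\alpha,\beta\in\Lambda$ with $d(\alpha)=\mathbf{n}$, $d(\beta)=\mathbf{m}$, $\lambda=\alpha\beta$. The codomain and domain of a morphism (path) $\lambda$ are $r(\lambda)$ and $s(\lambda)$; $\lambda\mu$ is defined when $s(\lambda)=r(\mu)$. $\Lambda^{\mathbf{n}}=d^{-1}(\mathbf{n})$;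 elements of $\Lambda^0$ are identified with objects (vertices). $v\Lambda=\{\lambda: r(\lambda)=v\}$, $v\Lambda^{\mathbf{n}}=v\Lambda\cap\Lambda^{\mathbf{n}}$. $\Lambda$ is row-finite without sources if $0<|v\Lambda^{\mathbf{n}}|<\infty$ for all $v,\mathbf{n}$. For $0\le\mathbf{n}\le\mathbf{m}\le d(\lambda)$, $\lambda(\mathbf{n},\mathbf{m})$ is the unique path of degree $\mathbf{m}-\mathbf{n}$ with $\lambda=\alpha\lambda(\mathbf{n},\mathbf{m})\beta$, $d(\alpha)=\mathbf{n}$, $d(\beta)=d(\lambda)-\mathbf{m}$. A loop is a path $\mu$ with $r(\mu)=s(\mu)$; it is nontrivial if it is not a vertex. An entrance to a loop $\mu$ is a path $\lambda\in s(\mu)\Lambda$ with $d(\lambda)\le d(\mu)$ and $\mu(0,d(\lambda))\ne\lambda$. Condition (HL): every nontrivial loop in $\Lambda$ has an entrance. Condition (HNE): no loop in $\Lambda$ has an entrance. The talented monoid $T_\Lambda$ is the commutative monoid generated by symbols $v(\mathbf{n})$ ($v\in\Lambda^0$, $\mathbf{n}\in\mathbb{Z}^k$) subject to $v(\mathbf{n})=\sum_{\alpha\in v\Lambda^{\mathbf{e}_i}}s(\alpha)(\mathbf{n}+\mathbf{e}_i)$ for all $v,\mathbf{n}$ and $1\le i\le k$. $\mathbb{Z}^k$ acts by ${}^{\mathbf{q}}v(\mathbf{n})=v(\mathbf{n}+\mathbf{q})$. $x\le y$ means $y=x+z$ for some $z$; $x<y$ means $x\le y$ and $x\neq y$. 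*)

theory Defs
  imports
    "HOL-Analysis.Finite_Cartesian_Product"
    "HOL-Library.Multiset"
    "HOL-Library.Countable_Set"
    "HOL-Algebra.Group"
begin

section \<open>Higher-rank graphs\<close>

text \<open>
  The rank k is the cardinality of the finite index type \<open>'k\<close> (so k is at least 1); degrees live in
  \<open>nat ^ 'k\<close>, which carries the coordinatewise order. Paths compose as in the literature on
  higher-rank graphs: \<open>cmp \<Lambda> \<alpha> \<beta>\<close> is meaningful when \<open>src \<Lambda> \<alpha> = rng \<Lambda> \<beta>\<close>.
\<close>

record ('v, 'p, 'k) kgraph_data =
  Obj :: "'v set"
  Mor :: "'p set"
  rng :: "'p \<Rightarrow> 'v"
  src :: "'p \<Rightarrow> 'v"
  idn :: "'v \<Rightarrow> 'p"
  cmp :: "'p \<Rightarrow> 'p \<Rightarrow> 'p"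
  deg :: "'p \<Rightarrow> nat ^ 'k"

locale k_graph =
  fixes \<Lambda> :: "('v, 'p, 'k::finite) kgraph_data"
  assumes countable_Mor: "countable (Mor \<Lambda>)"
    and rng_in_Obj: "\<xi> \<in> Mor \<Lambda> \<Longrightarrow> rng \<Lambda> \<xi> \<in> Obj \<Lambda>"
    and src_in_Obj: "\<xi> \<in> Mor \<Lambda> \<Longrightarrow> src \<Lambda> \<xi> \<in> Obj \<Lambda>"
    and idn_in_Mor: "v \<in> Obj \<Lambda> \<Longrightarrow> idn \<Lambda> v \<in> Mor \<Lambda>"
    and rng_idn: "v \<in> Obj \<Lambda> \<Longrightarrow> rng \<Lambda> (idn \<Lambda> v) = v"
    and src_idn: "v \<in> Obj \<Lambda> \<Longrightarrow> src \<Lambda> (idn \<Lambda> v) = v"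
    and cmp_in_Mor:
      "\<alpha> \<in> Mor \<Lambda> \<Longrightarrow> \<beta> \<in> Mor \<Lambda> \<Longrightarrow> src \<Lambda> \<alpha> = rng \<Lambda> \<beta> \<Longrightarrow> cmp \<Lambda> \<alpha> \<beta> \<in> Mor \<Lambda>"
    and rng_cmp:
      "\<alpha> \<in> Mor \<Lambda> \<Longrightarrow> \<beta> \<in> Mor \<Lambda> \<Longrightarrow> src \<Lambda> \<alpha> = rng \<Lambda> \<beta> \<Longrightarrow> rng \<Lambda> (cmp \<Lambda> \<alpha> \<beta>) = rng \<Lambda> \<alpha>"
    and src_cmp:
      "\<alpha> \<in> Mor \<Lambda> \<Longrightarrow> \<beta> \<in> Mor \<Lambda> \<Longrightarrow> src \<Lambda> \<alpha> = rng \<Lambda> \<beta> \<Longrightarrow> src \<Lambda> (cmp \<Lambda> \<alpha> \<beta>) = src \<Lambda> \<beta>"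
    and cmp_assoc:
      "\<alpha> \<in> Mor \<Lambda> \<Longrightarrow> \<beta> \<in> Mor \<Lambda> \<Longrightarrow> \<gamma> \<in> Mor \<Lambda> \<Longrightarrow> src \<Lambda> \<alpha> = rng \<Lambda> \<beta> \<Longrightarrow> src \<Lambda> \<beta> = rng \<Lambda> \<gamma>
        \<Longrightarrow> cmp \<Lambda> (cmp \<Lambda> \<alpha> \<beta>) \<gamma> = cmp \<Lambda> \<alpha> (cmp \<Lambda> \<beta> \<gamma>)"
    and idn_cmp: "\<xi> \<in> Mor \<Lambda> \<Longrightarrow> cmp \<Lambda> (idn \<Lambda> (rng \<Lambda> \<xi>)) \<xi> = \<xi>"
    and cmp_idn: "\<xi> \<in> Mor \<Lambda> \<Longrightarrow> cmp \<Lambda> \<xi> (idn \<Lambda> (src \<Lambda> \<xi>)) = \<xi>"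
    and deg_idn: "v \<in> Obj \<Lambda> \<Longrightarrow> deg \<Lambda> (idn \<Lambda> v) = 0"
    and deg_cmp:
      "\<alpha> \<in> Mor \<Lambda> \<Longrightarrow> \<beta> \<in> Mor \<Lambda> \<Longrightarrow> src \<Lambda> \<alpha> = rng \<Lambda> \<beta>
        \<Longrightarrow> deg \<Lambda> (cmp \<Lambda> \<alpha> \<beta>) = deg \<Lambda> \<alpha> + deg \<Lambda> \<beta>"
    and unique_factorisation:
      "\<xi> \<in> Mor \<Lambda> \<Longrightarrow> deg \<Lambda> \<xi> = n + m
        \<Longrightarrow> \<exists>!(\<alpha>, \<beta>). \<alpha> \<in> Mor \<Lambda> \<and> \<beta> \<in> Mor \<Lambda> \<and> src \<Lambda> \<alpha> = rng \<Lambda> \<beta>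
              \<and> deg \<Lambda> \<alpha> = n \<and> deg \<Lambda> \<beta> = m \<and> \<xi> = cmp \<Lambda> \<alpha> \<beta>"

definition paths_of_deg :: "('v, 'p, 'k::finite) kgraph_data \<Rightarrow> nat ^ 'k \<Rightarrow> 'p set" where
  "paths_of_deg \<Lambda> n = {\<xi> \<in> Mor \<Lambda>. deg \<Lambda> \<xi> = n}"

definition paths_at :: "('v, 'p, 'k::finite) kgraph_data \<Rightarrow> 'v \<Rightarrow> 'p set" where
  "paths_at \<Lambda> v = {\<xi> \<in> Mor \<Lambda>. rng \<Lambda> \<xi> = v}"

definition row_finite_no_sources :: "('v, 'p, 'k::finite) kgraph_data \<Rightarrow> bool" where
  "row_finite_no_sources \<Lambda> \<longleftrightarrow>
     (\<forall>v \<in> Obj \<Lambda>. \<forall>n. finite (paths_at \<Lambda> v \<inter> paths_of_deg \<Lambda> n) \<and>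
                       paths_at \<Lambda> v \<inter> paths_of_deg \<Lambda> n \<noteq> {})"

text \<open>Only meaningful for \<open>0 \<le> n \<le> m \<le> deg \<Lambda> \<xi>\<close>, where it is well defined (shown below).\<close>

definition segment ::
    "('v, 'p, 'k::finite) kgraph_data \<Rightarrow> 'p \<Rightarrow> nat ^ 'k \<Rightarrow> nat ^ 'k \<Rightarrow> 'p" where
  "segment \<Lambda> \<xi> n m =
     (THE \<gamma>. \<gamma> \<in> Mor \<Lambda> \<and> deg \<Lambda> \<gamma> = m - n \<and>
        (\<exists>\<alpha> \<in> Mor \<Lambda>. \<exists>\<beta> \<in> Mor \<Lambda>. src \<Lambda> \<alpha> = rng \<Lambda> \<gamma> \<and> src \<Lambda> \<gamma> = rng \<Lambda> \<beta> \<and>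
           deg \<Lambda> \<alpha> = n \<and> deg \<Lambda> \<beta> = deg \<Lambda> \<xi> - m \<and> \<xi> = cmp \<Lambda> \<alpha> (cmp \<Lambda> \<gamma> \<beta>)))"

definition is_loop :: "('v, 'p, 'k::finite) kgraph_data \<Rightarrow> 'p \<Rightarrow> bool" where
  "is_loop \<Lambda> \<mu> \<longleftrightarrow> \<mu> \<in> Mor \<Lambda> \<and> rng \<Lambda> \<mu> = src \<Lambda> \<mu>"

text \<open>A vertex, viewed as a path, is an identity morphism.\<close>

definition nontrivial_loop :: "('v, 'p, 'k::finite) kgraph_data \<Rightarrow> 'p \<Rightarrow> bool" where
  "nontrivial_loop \<Lambda> \<mu> \<longleftrightarrow> is_loop \<Lambda> \<mu> \<and> \<mu> \<notin> idn \<Lambda> ` Obj \<Lambda>"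

definition is_entrance :: "('v, 'p, 'k::finite) kgraph_data \<Rightarrow> 'p \<Rightarrow> 'p \<Rightarrow> bool" where
  "is_entrance \<Lambda> \<xi> \<mu> \<longleftrightarrow>
     \<xi> \<in> paths_at \<Lambda> (src \<Lambda> \<mu>) \<and> deg \<Lambda> \<xi> \<le> deg \<Lambda> \<mu> \<and> segment \<Lambda> \<mu> 0 (deg \<Lambda> \<xi>) \<noteq> \<xi>"

definition cond_HL :: "('v, 'p, 'k::finite) kgraph_data \<Rightarrow> bool" where
  "cond_HL \<Lambda> \<longleftrightarrow> (\<forall>\<mu>. nontrivial_loop \<Lambda> \<mu> \<longrightarrow> (\<exists>\<xi>. is_entrance \<Lambda> \<xi> \<mu>))"

definition cond_HNE :: "('v, 'p, 'k::finite) kgraph_data \<Rightarrow> bool" where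
  "cond_HNE \<Lambda> \<longleftrightarrow> \<not> (\<exists>\<mu>. is_loop \<Lambda> \<mu> \<and> (\<exists>\<xi>. is_entrance \<Lambda> \<xi> \<mu>))"


section \<open>The talented monoid\<close>

text \<open>
  The free commutative monoid on the symbols \<open>v(n)\<close> consists of the finite multisets of pairs
  \<open>(v, n)\<close> with \<open>v\<close> a vertex and \<open>n\<close> in \<open>int ^ 'k\<close>.
\<close>

definition talented_words ::
    "('v, 'p, 'k::finite) kgraph_data \<Rightarrow> ('v \<times> (int ^ 'k)) multiset set" where
  "talented_words \<Lambda> = {x. set_mset x \<subseteq> Obj \<Lambda> \<times> UNIV}"

text \<open>
  The least monoid congruence on \<^const>\<open>talented_words\<close> containing the defining relations.
  (\<^const>\<open>mset_set\<close> is empty on infinite sets; row-finiteness rules these out.)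
\<close>

inductive talented_eq ::
    "('v, 'p, 'k::finite) kgraph_data
      \<Rightarrow> ('v \<times> (int ^ 'k)) multiset \<Rightarrow> ('v \<times> (int ^ 'k)) multiset \<Rightarrow> bool"
  for \<Lambda> :: "('v, 'p, 'k::finite) kgraph_data"
where
  gen: "v \<in> Obj \<Lambda> \<Longrightarrow>
    talented_eq \<Lambda> {#(v, n)#}
      {#(src \<Lambda> \<alpha>, n + axis i 1).
          \<alpha> \<in># mset_set (paths_at \<Lambda> v \<inter> paths_of_deg \<Lambda> (axis i 1))#}"
| refl: "x \<in> talented_words \<Lambda> \<Longrightarrow> talented_eq \<Lambda> x x"
| sym: "talented_eq \<Lambda> x y \<Longrightarrow> talented_eq \<Lambda> y x"
| trans: "talented_eq \<Lambda> x y \<Longrightarrow> talented_eq \<Lambda> y z \<Longrightarrow> talented_eq \<Lambda> x z"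
| add: "talented_eq \<Lambda> x y \<Longrightarrow> talented_eq \<Lambda> x' y' \<Longrightarrow> talented_eq \<Lambda> (x + x') (y + y')"

definition talented_class ::
    "('v, 'p, 'k::finite) kgraph_data
      \<Rightarrow> ('v \<times> (int ^ 'k)) multiset \<Rightarrow> ('v \<times> (int ^ 'k)) multiset set" where
  "talented_class \<Lambda> x = {y. talented_eq \<Lambda> x y}"

text \<open>
  The monoid record is multiplicative: \<open>\<otimes>\<close> is the addition of the talented monoid and
  \<open>\<one>\<close> its zero.
\<close>

definition talented_monoid ::
    "('v, 'p, 'k::finite) kgraph_data \<Rightarrow> ('v \<times> (int ^ 'k)) multiset set monoid" where
  "talented_monoid \<Lambda> =
     \<lparr> carrier = talented_words \<Lambda> // {(x, y). talented_eq \<Lambda> x y},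
       mult = (\<lambda>X Y. {z. \<exists>x \<in> X. \<exists>y \<in> Y. talented_eq \<Lambda> (x + y) z}),
       one = talented_class \<Lambda> {#} \<rparr>"

text \<open>
  The action shifts every word of a class; the image of a class is again a class because the
  shift is invertible and respects the congruence (shown below).
\<close>

definition shift_word ::
    "int ^ 'k \<Rightarrow> ('v \<times> (int ^ 'k)) multiset \<Rightarrow> ('v \<times> (int ^ 'k::finite)) multiset" where
  "shift_word q x = {#(v, n + q). (v, n) \<in># x#}"

definition talented_act ::
    "int ^ 'k \<Rightarrow> ('v \<times> (int ^ 'k)) multiset set \<Rightarrow> ('v \<times> (int ^ 'k::finite)) multiset set" where
  "talented_act q X = shift_word q ` X"

definition alg_le :: "('m, 'x) monoid_scheme \<Rightarrow> 'm \<Rightarrow> 'm \<Rightarrow> bool" where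
  "alg_le M x y \<longleftrightarrow> (\<exists>z \<in> carrier M. y = x \<otimes>\<^bsub>M\<^esub> z)"

definition alg_less :: "('m, 'x) monoid_scheme \<Rightarrow> 'm \<Rightarrow> 'm \<Rightarrow> bool" where
  "alg_less M x y \<longleftrightarrow> alg_le M x y \<and> x \<noteq> y"

definition neg_tuples :: "(int ^ 'k::finite) set" where
  "neg_tuples = {n. n \<le> 0 \<and> n \<noteq> 0}"

definition int_tuple :: "nat ^ 'k \<Rightarrow> int ^ 'k::finite" where
  "int_tuple q = (\<chi> i. int (q $ i))"


section \<open>The definitions behave as intended\<close>

lemma (in k_graph) deg_0_paths: "paths_of_deg \<Lambda> 0 = idn \<Lambda> ` Obj \<Lambda>"
proof
  show "idn \<Lambda> ` Obj \<Lambda> \<subseteq> paths_of_deg \<Lambda> 0"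
    by (auto simp: paths_of_deg_def idn_in_Mor deg_idn)
  show "paths_of_deg \<Lambda> 0 \<subseteq> idn \<Lambda> ` Obj \<Lambda>"
  proof
    fix \<xi> assume "\<xi> \<in> paths_of_deg \<Lambda> 0"
    then have l: "\<xi> \<in> Mor \<Lambda>" and d: "deg \<Lambda> \<xi> = 0" by (auto simp: paths_of_deg_def)
    let ?P = "\<lambda>(\<alpha>, \<beta>). \<alpha> \<in> Mor \<Lambda> \<and> \<beta> \<in> Mor \<Lambda> \<and> src \<Lambda> \<alpha> = rng \<Lambda> \<beta>
              \<and> deg \<Lambda> \<alpha> = 0 \<and> deg \<Lambda> \<beta> = 0 \<and> \<xi> = cmp \<Lambda> \<alpha> \<beta>"
    have "\<exists>!p. ?P p" using unique_factorisation[OF l, of 0 0] d by simp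
    moreover have "?P (idn \<Lambda> (rng \<Lambda> \<xi>), \<xi>)"
      using l d by (simp add: idn_cmp idn_in_Mor rng_in_Obj src_idn deg_idn)
    moreover have "?P (\<xi>, idn \<Lambda> (src \<Lambda> \<xi>))"
      using l d by (simp add: cmp_idn idn_in_Mor src_in_Obj rng_idn deg_idn)
    ultimately have "(idn \<Lambda> (rng \<Lambda> \<xi>), \<xi>) = (\<xi>, idn \<Lambda> (src \<Lambda> \<xi>))" by blast
    then show "\<xi> \<in> idn \<Lambda> ` Obj \<Lambda>" using l rng_in_Obj by (metis image_eqI prod.inject)
  qed
qed

lemma (in k_graph) inj_on_idn: "inj_on (idn \<Lambda>) (Obj \<Lambda>)"
  by (metis inj_onI rng_idn)

lemma (in k_graph) segment_ex1:
  assumes l: "\<xi> \<in> Mor \<Lambda>" and "n \<le> m" and "m \<le> deg \<Lambda> \<xi>"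
  shows "\<exists>!\<gamma>. \<gamma> \<in> Mor \<Lambda> \<and> deg \<Lambda> \<gamma> = m - n \<and>
        (\<exists>\<alpha> \<in> Mor \<Lambda>. \<exists>\<beta> \<in> Mor \<Lambda>. src \<Lambda> \<alpha> = rng \<Lambda> \<gamma> \<and> src \<Lambda> \<gamma> = rng \<Lambda> \<beta> \<and>
           deg \<Lambda> \<alpha> = n \<and> deg \<Lambda> \<beta> = deg \<Lambda> \<xi> - m \<and> \<xi> = cmp \<Lambda> \<alpha> (cmp \<Lambda> \<gamma> \<beta>))"
    (is "\<exists>!\<gamma>. ?P \<gamma>")
proof -
  have e: "deg \<Lambda> \<xi> = n + ((m - n) + (deg \<Lambda> \<xi> - m))"
    using assms by (simp add: vec_eq_iff less_eq_vec_def) (metis le_add_diff_inverse le_trans)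
  note U1 = unique_factorisation[OF l e]
  obtain \<alpha> \<tau> where 1: "\<alpha> \<in> Mor \<Lambda>" "\<tau> \<in> Mor \<Lambda>" "src \<Lambda> \<alpha> = rng \<Lambda> \<tau>" "deg \<Lambda> \<alpha> = n"
      "deg \<Lambda> \<tau> = (m - n) + (deg \<Lambda> \<xi> - m)" "\<xi> = cmp \<Lambda> \<alpha> \<tau>"
    using ex1_implies_ex[OF U1] by auto
  note U2 = unique_factorisation[OF 1(2) 1(5)]
  obtain \<gamma> \<beta> where 2: "\<gamma> \<in> Mor \<Lambda>" "\<beta> \<in> Mor \<Lambda>" "src \<Lambda> \<gamma> = rng \<Lambda> \<beta>" "deg \<Lambda> \<gamma> = m - n"
      "deg \<Lambda> \<beta> = deg \<Lambda> \<xi> - m" "\<tau> = cmp \<Lambda> \<gamma> \<beta>"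
    using ex1_implies_ex[OF U2] by auto
  show ?thesis
  proof (rule ex1I[of _ \<gamma>])
    show "?P \<gamma>"
      using 1 2 by (intro conjI bexI[of _ \<alpha>] bexI[of _ \<beta>]) (auto simp: rng_cmp)
  next
    fix \<delta> assume "?P \<delta>"
    then obtain \<alpha>' \<beta>' where 3: "\<delta> \<in> Mor \<Lambda>" "deg \<Lambda> \<delta> = m - n" "\<alpha>' \<in> Mor \<Lambda>" "\<beta>' \<in> Mor \<Lambda>"
      "src \<Lambda> \<alpha>' = rng \<Lambda> \<delta>" "src \<Lambda> \<delta> = rng \<Lambda> \<beta>'" "deg \<Lambda> \<alpha>' = n" "deg \<Lambda> \<beta>' = deg \<Lambda> \<xi> - m"
      "\<xi> = cmp \<Lambda> \<alpha>' (cmp \<Lambda> \<delta> \<beta>')" by blast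
    then have 4: "cmp \<Lambda> \<delta> \<beta>' \<in> Mor \<Lambda>" "rng \<Lambda> (cmp \<Lambda> \<delta> \<beta>') = rng \<Lambda> \<delta>"
      "deg \<Lambda> (cmp \<Lambda> \<delta> \<beta>') = (m - n) + (deg \<Lambda> \<xi> - m)"
      by (simp_all add: cmp_in_Mor rng_cmp deg_cmp)
    let ?Q = "\<lambda>(\<alpha>, \<beta>). \<alpha> \<in> Mor \<Lambda> \<and> \<beta> \<in> Mor \<Lambda> \<and> src \<Lambda> \<alpha> = rng \<Lambda> \<beta>
              \<and> deg \<Lambda> \<alpha> = n \<and> deg \<Lambda> \<beta> = (m - n) + (deg \<Lambda> \<xi> - m) \<and> \<xi> = cmp \<Lambda> \<alpha> \<beta>"
    have "?Q (\<alpha>, \<tau>)" using 1 by simp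
    moreover have "?Q (\<alpha>', cmp \<Lambda> \<delta> \<beta>')" using 3 4 by simp
    ultimately have "(\<alpha>, \<tau>) = (\<alpha>', cmp \<Lambda> \<delta> \<beta>')" using U1 by blast
    then have t: "\<tau> = cmp \<Lambda> \<delta> \<beta>'" by simp
    let ?R = "\<lambda>(\<gamma>, \<beta>). \<gamma> \<in> Mor \<Lambda> \<and> \<beta> \<in> Mor \<Lambda> \<and> src \<Lambda> \<gamma> = rng \<Lambda> \<beta>
              \<and> deg \<Lambda> \<gamma> = m - n \<and> deg \<Lambda> \<beta> = deg \<Lambda> \<xi> - m \<and> \<tau> = cmp \<Lambda> \<gamma> \<beta>"
    have "?R (\<gamma>, \<beta>)" using 2 by simp
    moreover have "?R (\<delta>, \<beta>')" using 3 t by simp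
    ultimately have "(\<gamma>, \<beta>) = (\<delta>, \<beta>')" using U2 by blast
    then show "\<delta> = \<gamma>" by simp
  qed
qed

lemma (in k_graph) talented_eq_words:
  "talented_eq \<Lambda> x y \<Longrightarrow> x \<in> talented_words \<Lambda> \<and> y \<in> talented_words \<Lambda>"
proof (induction rule: talented_eq.induct)
  case (gen v n i)
  have "set_mset (mset_set A) \<subseteq> A" for A :: "'b set"
    by (cases "finite A") auto
  then show ?case
    using gen src_in_Obj by (fastforce simp: talented_words_def paths_of_deg_def)
qed (auto simp: talented_words_def)

lemma (in k_graph) equiv_talented_eq:
  "equiv (talented_words \<Lambda>) {(x, y). talented_eq \<Lambda> x y}"
  by (intro equivI refl_onI symI transI subsetI)
    (auto intro: talented_eq.intros dest: talented_eq_words)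

lemma (in k_graph) carrier_talented_monoid:
  "carrier (talented_monoid \<Lambda>) = talented_class \<Lambda> ` talented_words \<Lambda>"
  by (auto simp: talented_monoid_def talented_class_def quotient_def Image_def)

lemma (in k_graph) talented_class_eq_iff:
  assumes "x \<in> talented_words \<Lambda>"
  shows "talented_class \<Lambda> x = talented_class \<Lambda> y \<longleftrightarrow> talented_eq \<Lambda> x y"
  using assms unfolding talented_class_def
  by (blast intro: talented_eq.intros)

lemma (in k_graph) talented_mult:
  assumes "x \<in> talented_words \<Lambda>" "y \<in> talented_words \<Lambda>"
  shows "talented_class \<Lambda> x \<otimes>\<^bsub>talented_monoid \<Lambda>\<^esub> talented_class \<Lambda> y = talented_class \<Lambda> (x + y)"
  using assms unfolding talented_monoid_def talented_class_def
  by (auto intro: talented_eq.intros)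

lemma (in k_graph) comm_monoid_talented_monoid: "comm_monoid (talented_monoid \<Lambda>)"
proof -
  have [simp]: "{#} \<in> talented_words \<Lambda>"
    "x \<in> talented_words \<Lambda> \<Longrightarrow> y \<in> talented_words \<Lambda> \<Longrightarrow> x + y \<in> talented_words \<Lambda>" for x y
    by (auto simp: talented_words_def)
  have one: "\<one>\<^bsub>talented_monoid \<Lambda>\<^esub> = talented_class \<Lambda> {#}"
    by (simp add: talented_monoid_def)
  show ?thesis
    by (rule comm_monoidI) (auto simp: carrier_talented_monoid talented_mult one ac_simps)
qed

lemma shift_word_simps:
  "shift_word q {#} = {#}" "shift_word q (x + y) = shift_word q x + shift_word q y"
  "shift_word q (shift_word p x) = shift_word (p + q) x" "shift_word 0 x = x"
  by (simp_all add: shift_word_def image_mset.compositionality comp_def case_prod_beta' add.assoc)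

lemma (in k_graph) talented_eq_shift:
  "talented_eq \<Lambda> x y \<Longrightarrow> talented_eq \<Lambda> (shift_word q x) (shift_word q y)"
proof (induction rule: talented_eq.induct)
  case (gen v n i)
  then show ?case
    using talented_eq.gen[of v \<Lambda> "n + q" i]
    by (simp add: shift_word_def image_mset.compositionality comp_def add.commute add.left_commute)
next
  case (refl x)
  then have "shift_word q x \<in> talented_words \<Lambda>"
    by (auto simp: talented_words_def shift_word_def)
  then show ?case by (rule talented_eq.refl)
qed (auto simp: shift_word_simps intro: talented_eq.sym talented_eq.trans talented_eq.add)

lemma (in k_graph) talented_act_class:
  "talented_act q (talented_class \<Lambda> x) = talented_class \<Lambda> (shift_word q x)"
proof
  show "talented_act q (talented_class \<Lambda> x) \<subseteq> talented_class \<Lambda> (shift_word q x)"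
    by (auto simp: talented_act_def talented_class_def talented_eq_shift)
  show "talented_class \<Lambda> (shift_word q x) \<subseteq> talented_act q (talented_class \<Lambda> x)"
  proof
    fix y assume "y \<in> talented_class \<Lambda> (shift_word q x)"
    then have "talented_eq \<Lambda> x (shift_word (- q) y)"
      using talented_eq_shift[of "shift_word q x" y "- q"]
      by (simp add: talented_class_def shift_word_simps)
    moreover have "y = shift_word q (shift_word (- q) y)" by (simp add: shift_word_simps)
    ultimately show "y \<in> talented_act q (talented_class \<Lambda> x)"
      unfolding talented_act_def talented_class_def by blast
  qed
qed

end

theory Submission
  imports Defs
begin

text \<open>
  Expanding every symbol \<open>v(n)\<close> of a word up to one sufficiently high common level turns the word
  into a finite multiset of vertices, and two words represent the same element of the talented monoid
  iff these multisets eventually agree. Expansion by \<open>p\<close> (\<open>evolve p\<close>) is additive and replaces \<open>v\<close>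
  by the sources of the paths in \<open>v\<Lambda>\<^sup>p\<close>, so it never decreases the size. A loop at \<open>v\<close> of degree
  \<open>p\<close> has no entrance iff \<open>evolve p\<close> fixes \<open>{#v#}\<close>. Equations such as \<open>evolve p N = N\<close> or
  \<open>evolve q N = N + Z\<close> then produce, by the pigeonhole principle on walks in the finite
  support of \<open>N\<close>, cycles to which (HL) or (HNE) applies.
\<close>

section \<open>Arithmetic of degrees and a pigeonhole principle\<close>

definition scale :: "nat \<Rightarrow> nat ^ 'k \<Rightarrow> nat ^ 'k::finite" where
  "scale j q = (\<chi> i. j * q $ i)"

text \<open>Negative entries are truncated to 0, so \<open>nat_tuple (m - n)\<close> is the true
  difference only when \<open>n\<close> lies below \<open>m\<close>.\<close>

definition nat_tuple :: "int ^ 'k \<Rightarrow> nat ^ 'k::finite" where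
  "nat_tuple z = (\<chi> i. nat (z $ i))"

definition at_level :: "int ^ 'k \<Rightarrow> 'v multiset \<Rightarrow> ('v \<times> (int ^ 'k::finite)) multiset" where
  "at_level m M = {#(v, m). v \<in># M#}"

lemma scale_simps [simp]:
  "scale 0 q = 0" "scale (Suc 0) q = q" "scale j 0 = 0"
  by (simp_all add: scale_def vec_eq_iff)

lemma scale_add: "scale (i + j) q = scale i q + scale j q"
  by (simp add: scale_def vec_eq_iff algebra_simps)

lemma scale_scale: "scale i (scale j q) = scale (i * j) q"
  by (simp add: scale_def vec_eq_iff algebra_simps)

lemma scale_eq_0_iff: "scale j q = 0 \<longleftrightarrow> j = 0 \<or> q = 0"
  by (auto simp: scale_def vec_eq_iff)

lemma int_tuple_add: "int_tuple (p + q) = int_tuple p + int_tuple q"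
  by (simp add: int_tuple_def vec_eq_iff)

lemma int_tuple_0 [simp]: "int_tuple 0 = 0"
  by (simp add: int_tuple_def vec_eq_iff)

lemma int_tuple_axis: "int_tuple (axis i n) = axis i (int n)"
  by (simp add: int_tuple_def vec_eq_iff axis_def)

lemma nat_tuple_int_tuple [simp]: "nat_tuple (int_tuple p) = p"
  by (simp add: int_tuple_def nat_tuple_def vec_eq_iff)

lemma le_obtain_int_tuple:
  assumes "m \<le> l"
  obtains p where "l = m + int_tuple p"
proof
  show "l = m + int_tuple (nat_tuple (l - m))"
    using assms by (simp add: less_eq_vec_def int_tuple_def nat_tuple_def vec_eq_iff)
qed

lemma vec_upper_bound:
  fixes m n :: "int ^ 'k::finite"
  obtains l where "m \<le> l" "n \<le> l"
proof
  show "m \<le> (\<chi> i. max (m $ i) (n $ i))" "n \<le> (\<chi> i. max (m $ i) (n $ i))"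
    by (simp_all add: less_eq_vec_def)
qed

text \<open>Induction on the sum of the coordinates. The step adds one unit vector because the
  defining relations of the talented monoid expand in one direction at a time.\<close>

lemma nat_vec_induct [case_names zero step]:
  fixes p :: "nat ^ 'k::finite"
  assumes "P 0" and "\<And>p i. P p \<Longrightarrow> P (axis i 1 + p)"
  shows "P p"
proof (induction "\<Sum>i\<in>UNIV. p $ i" arbitrary: p)
  case 0
  then have "p = 0" by (simp add: vec_eq_iff)
  then show ?case using assms by simp
next
  case (Suc n)
  obtain i where i: "p $ i \<noteq> 0" using Suc.hyps(2) by (metis nat.simps(3) sum.neutral)
  define p' where "p' = (\<chi> j. p $ j - (if j = i then 1 else 0))"
  have p: "p = axis i 1 + p'"
    using i by (auto simp: p'_def vec_eq_iff axis_def)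
  have "(\<Sum>j\<in>UNIV. p $ j) = (\<Sum>j\<in>UNIV. (if j = i then 1 else 0) + p' $ j)"
    by (intro sum.cong) (auto simp: p axis_def)
  then have "(\<Sum>j\<in>UNIV. p $ j) = Suc (\<Sum>j\<in>UNIV. p' $ j)"
    by (simp add: sum.distrib)
  then have "P p'" using Suc by simp
  then show ?case using assms p by simp
qed

lemma at_level_simps [simp]:
  "at_level m {#} = {#}" "at_level m (M + N) = at_level m M + at_level m N"
  "at_level m (add_mset v M) = add_mset (v, m) (at_level m M)"
  by (simp_all add: at_level_def)

lemma shift_word_at_level: "shift_word q (at_level m M) = at_level (m + q) M"
  by (simp add: at_level_def shift_word_def image_mset.compositionality comp_def)

text \<open>Pigeonhole on the \<open>card S + 1\<close> indices from 0 to \<open>card S\<close>. The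
  bound on \<open>j\<close> keeps the repetition inside a walk of length \<open>card S\<close> and
  makes \<open>j - i\<close> divide \<open>fact (card S)\<close>.\<close>

lemma sequence_repeats:
  assumes "finite S" and "\<And>i. i \<le> card S \<Longrightarrow> c i \<in> S"
  obtains i j :: nat where "i < j" "j \<le> card S" "c i = c j"
proof -
  have "card (c ` {..card S}) \<le> card S"
    using assms by (intro card_mono) auto
  then have "\<not> inj_on c {..card S}" by (intro pigeonhole) simp
  then obtain i j where "i \<le> card S" "j \<le> card S" "i \<noteq> j" "c i = c j"
    by (auto simp: inj_on_def)
  then show ?thesis using that by (cases i j rule: linorder_cases) metis+
qed

section \<open>Expansion of vertex multisets along paths\<close>

locale row_finite_k_graph = k_graph \<Lambda> for \<Lambda> :: "('v, 'p, 'k::finite) kgraph_data" +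
  assumes row_finite: "row_finite_no_sources \<Lambda>"
begin

definition vpaths :: "'v \<Rightarrow> nat ^ 'k \<Rightarrow> 'p set" where
  "vpaths v p = {\<alpha> \<in> Mor \<Lambda>. rng \<Lambda> \<alpha> = v \<and> deg \<Lambda> \<alpha> = p}"

text \<open>The row of \<open>v\<close> in the degree-\<open>p\<close> adjacency matrix, kept as a
  multiset so that parallel paths count separately. On an infinite set of paths the sum would
  default to the empty multiset; row-finiteness excludes this for vertices.\<close>

definition desc :: "nat ^ 'k \<Rightarrow> 'v \<Rightarrow> 'v multiset" where
  "desc p v = (\<Sum>\<alpha>\<in>vpaths v p. {#src \<Lambda> \<alpha>#})"

definition evolve :: "nat ^ 'k \<Rightarrow> 'v multiset \<Rightarrow> 'v multiset" where
  "evolve p M = (\<Sum>v\<in>#M. desc p v)"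

lemma vpaths_iff: "\<alpha> \<in> vpaths v p \<longleftrightarrow> \<alpha> \<in> Mor \<Lambda> \<and> rng \<Lambda> \<alpha> = v \<and> deg \<Lambda> \<alpha> = p"
  by (simp add: vpaths_def)

lemma paths_Int: "paths_at \<Lambda> v \<inter> paths_of_deg \<Lambda> p = vpaths v p"
  by (auto simp: paths_at_def paths_of_deg_def vpaths_def)

lemma finite_vpaths: "v \<in> Obj \<Lambda> \<Longrightarrow> finite (vpaths v p)"
  and vpaths_nonempty: "v \<in> Obj \<Lambda> \<Longrightarrow> vpaths v p \<noteq> {}"
  using row_finite unfolding row_finite_no_sources_def paths_Int by auto

lemma desc_altdef: "desc p v = {#src \<Lambda> \<alpha>. \<alpha> \<in># mset_set (vpaths v p)#}"
  by (simp add: desc_def sum_unfold_sum_mset)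

lemma set_desc: "v \<in> Obj \<Lambda> \<Longrightarrow> set_mset (desc p v) = src \<Lambda> ` vpaths v p"
  by (simp add: desc_altdef finite_vpaths)

lemma desc_Obj: "v \<in> Obj \<Lambda> \<Longrightarrow> set_mset (desc p v) \<subseteq> Obj \<Lambda>"
  by (auto simp: set_desc vpaths_iff src_in_Obj)

lemma size_desc: "v \<in> Obj \<Lambda> \<Longrightarrow> size (desc p v) = card (vpaths v p)"
  by (simp add: desc_altdef)

lemma size_desc_ge: "v \<in> Obj \<Lambda> \<Longrightarrow> 1 \<le> size (desc p v)"
  using vpaths_nonempty[of v p] finite_vpaths[of v p]
  by (simp add: size_desc Suc_le_eq card_gt_0_iff)

lemma evolve_simps [simp]:
  "evolve p {#} = {#}" "evolve p (M + N) = evolve p M + evolve p N"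
  "evolve p (add_mset v M) = desc p v + evolve p M"
  by (simp_all add: evolve_def)

lemma evolve_sum: "evolve p (\<Sum>x\<in>A. f x) = (\<Sum>x\<in>A. evolve p (f x))"
  by (induction A rule: infinite_finite_induct) auto

lemma set_evolve: "set_mset (evolve p M) = (\<Union>v\<in>set_mset M. set_mset (desc p v))"
  by (induction M) auto

lemma evolve_Obj: "set_mset M \<subseteq> Obj \<Lambda> \<Longrightarrow> set_mset (evolve p M) \<subseteq> Obj \<Lambda>"
  using desc_Obj by (auto simp: set_evolve)

text \<open>Without sources every vertex has a successor, so expansion never loses symbols. Hence an
  unchanged total size forces exactly one successor per symbol.\<close>

lemma size_evolve_ge: "set_mset M \<subseteq> Obj \<Lambda> \<Longrightarrow> size M \<le> size (evolve p M)"
  by (induction M) (auto dest: size_desc_ge[of _ p])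

lemma evolve_cong_id: "(\<And>v. v \<in># M \<Longrightarrow> desc p v = {#v#}) \<Longrightarrow> evolve p M = M"
  by (induction M) auto

lemma evolve_eq_empty_iff: "set_mset M \<subseteq> Obj \<Lambda> \<Longrightarrow> evolve p M = {#} \<longleftrightarrow> M = {#}"
  using size_evolve_ge[of M p] by auto

lemma vpaths_0: "v \<in> Obj \<Lambda> \<Longrightarrow> vpaths v 0 = {idn \<Lambda> v}"
  using deg_0_paths by (auto simp: paths_Int[symmetric] paths_at_def rng_idn idn_in_Mor)

lemma desc_0: "v \<in> Obj \<Lambda> \<Longrightarrow> desc 0 v = {#v#}"
  by (simp add: desc_def vpaths_0 src_idn)

lemma cmp_unique:
  assumes "\<alpha> \<in> Mor \<Lambda>" "\<beta> \<in> Mor \<Lambda>" "src \<Lambda> \<alpha> = rng \<Lambda> \<beta>"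
    and "\<alpha>' \<in> Mor \<Lambda>" "\<beta>' \<in> Mor \<Lambda>" "src \<Lambda> \<alpha>' = rng \<Lambda> \<beta>'"
    and "deg \<Lambda> \<alpha> = deg \<Lambda> \<alpha>'" "deg \<Lambda> \<beta> = deg \<Lambda> \<beta>'" "cmp \<Lambda> \<alpha> \<beta> = cmp \<Lambda> \<alpha>' \<beta>'"
  shows "\<alpha> = \<alpha>' \<and> \<beta> = \<beta>'"
proof -
  let ?P = "\<lambda>(\<gamma>, \<delta>). \<gamma> \<in> Mor \<Lambda> \<and> \<delta> \<in> Mor \<Lambda> \<and> src \<Lambda> \<gamma> = rng \<Lambda> \<delta>
    \<and> deg \<Lambda> \<gamma> = deg \<Lambda> \<alpha> \<and> deg \<Lambda> \<delta> = deg \<Lambda> \<beta> \<and> cmp \<Lambda> \<alpha> \<beta> = cmp \<Lambda> \<gamma> \<delta>"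
  have "\<exists>!x. ?P x"
    using assms(1-3) by (intro unique_factorisation) (simp_all add: cmp_in_Mor deg_cmp)
  moreover have "?P (\<alpha>, \<beta>)" "?P (\<alpha>', \<beta>')" using assms by simp_all
  ultimately have "(\<alpha>, \<beta>) = (\<alpha>', \<beta>')" by blast
  then show ?thesis by simp
qed

text \<open>By the factorisation property, composition is a bijection from composable pairs of
  degrees \<open>p\<close> and \<open>q\<close> onto the paths of degree \<open>p + q\<close>. This
  makes \<open>evolve\<close> an action of the additive monoid of degrees on multisets of
  vertices.\<close>

lemma desc_add:
  assumes v: "v \<in> Obj \<Lambda>"
  shows "desc (p + q) v = evolve q (desc p v)"
proof -
  let ?S = "SIGMA \<alpha>:vpaths v p. vpaths (src \<Lambda> \<alpha>) q"
  have bij: "bij_betw (\<lambda>(\<alpha>, \<beta>). cmp \<Lambda> \<alpha> \<beta>) ?S (vpaths v (p + q))"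
  proof (rule bij_betw_imageI)
    show "inj_on (\<lambda>(\<alpha>, \<beta>). cmp \<Lambda> \<alpha> \<beta>) ?S"
      \<comment> \<open>\<open>rotated -1\<close> moves the equation between the two composites to
        the front, so that \<open>dest!\<close> fires on it.\<close>
      by (rule inj_onI) (auto simp: vpaths_iff dest!: cmp_unique[rotated -1])
  next
    have "\<xi> \<in> (\<lambda>(\<alpha>, \<beta>). cmp \<Lambda> \<alpha> \<beta>) ` ?S" if "\<xi> \<in> vpaths v (p + q)" for \<xi>
    proof -
      from that have \<xi>: "\<xi> \<in> Mor \<Lambda>" "rng \<Lambda> \<xi> = v" "deg \<Lambda> \<xi> = p + q"
        unfolding vpaths_iff by auto
      obtain \<alpha> \<beta> where "\<alpha> \<in> Mor \<Lambda>" "\<beta> \<in> Mor \<Lambda>" "src \<Lambda> \<alpha> = rng \<Lambda> \<beta>"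
        "deg \<Lambda> \<alpha> = p" "deg \<Lambda> \<beta> = q" "\<xi> = cmp \<Lambda> \<alpha> \<beta>"
        using ex1_implies_ex[OF unique_factorisation[OF \<xi>(1,3)]] by auto
      moreover from this have "rng \<Lambda> \<alpha> = v" using \<xi> by (simp add: rng_cmp)
      ultimately show ?thesis
        by (intro image_eqI[of _ _ "(\<alpha>, \<beta>)"]) (simp_all add: vpaths_iff)
    qed
    then show "(\<lambda>(\<alpha>, \<beta>). cmp \<Lambda> \<alpha> \<beta>) ` ?S = vpaths v (p + q)"
      by (auto simp: vpaths_iff cmp_in_Mor rng_cmp deg_cmp)
  qed
  have fin: "\<forall>\<alpha>\<in>vpaths v p. finite (vpaths (src \<Lambda> \<alpha>) q)"
    by (auto simp: vpaths_iff src_in_Obj finite_vpaths)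
  have "evolve q (desc p v) = (\<Sum>\<alpha>\<in>vpaths v p. \<Sum>\<beta>\<in>vpaths (src \<Lambda> \<alpha>) q. {#src \<Lambda> \<beta>#})"
    by (simp add: desc_def evolve_sum)
  also have "\<dots> = (\<Sum>(\<alpha>, \<beta>)\<in>?S. {#src \<Lambda> \<beta>#})"
    by (rule sum.Sigma[OF finite_vpaths[OF v] fin])
  also have "\<dots> = (\<Sum>x\<in>?S. {#src \<Lambda> ((\<lambda>(\<alpha>, \<beta>). cmp \<Lambda> \<alpha> \<beta>) x)#})"
    by (rule sum.cong) (auto simp: vpaths_iff src_cmp)
  also have "\<dots> = desc (p + q) v"
    unfolding desc_def by (rule sum.reindex_bij_betw[OF bij])
  finally show ?thesis ..
qed

lemma evolve_add: "set_mset M \<subseteq> Obj \<Lambda> \<Longrightarrow> evolve (p + q) M = evolve q (evolve p M)"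
  by (induction M) (auto simp: desc_add)

lemma evolve_evolve: "set_mset M \<subseteq> Obj \<Lambda> \<Longrightarrow> evolve q (evolve p M) = evolve (q + p) M"
  using evolve_add[of M p q] by (simp add: add.commute)

section \<open>Entrances expressed through numbers of paths\<close>

lemma segment_prefix:
  assumes "\<xi> \<in> Mor \<Lambda>" "\<beta> \<in> Mor \<Lambda>" "src \<Lambda> \<xi> = rng \<Lambda> \<beta>"
  shows "segment \<Lambda> (cmp \<Lambda> \<xi> \<beta>) 0 (deg \<Lambda> \<xi>) = \<xi>"
proof -
  have *: "cmp \<Lambda> \<xi> \<beta> \<in> Mor \<Lambda>" "0 \<le> deg \<Lambda> \<xi>" "deg \<Lambda> \<xi> \<le> deg \<Lambda> (cmp \<Lambda> \<xi> \<beta>)"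
    using assms by (auto simp: cmp_in_Mor deg_cmp less_eq_vec_def)
  \<comment> \<open>The segment starts at 0, so the factor before it is an identity. This exhibits
    \<open>\<xi>\<close> as a middle factor, and \<open>segment_ex1\<close> gives
    uniqueness.\<close>
  have "cmp \<Lambda> \<xi> \<beta> = cmp \<Lambda> (idn \<Lambda> (rng \<Lambda> \<xi>)) (cmp \<Lambda> \<xi> \<beta>)"
    using idn_cmp[OF *(1)] assms by (simp add: rng_cmp)
  then show ?thesis
    unfolding segment_def using assms
    by (intro the1_equality[OF segment_ex1[OF *]] conjI bexI[of _ \<beta>]
          bexI[of _ "idn \<Lambda> (rng \<Lambda> \<xi>)"])
      (simp_all add: deg_cmp src_idn idn_in_Mor rng_in_Obj deg_idn)
qed

text \<open>An entrance extends, since there are no sources, to a path of the full degree of the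
  loop; that path differs from the loop because their prefixes differ. Conversely, a second path of
  full degree is itself an entrance.\<close>

lemma entrance_iff:
  assumes "is_loop \<Lambda> \<mu>"
  shows "(\<exists>\<xi>. is_entrance \<Lambda> \<xi> \<mu>) \<longleftrightarrow> vpaths (src \<Lambda> \<mu>) (deg \<Lambda> \<mu>) \<noteq> {\<mu>}"
proof
  have \<mu>: "\<mu> \<in> Mor \<Lambda>" "rng \<Lambda> \<mu> = src \<Lambda> \<mu>" using assms by (auto simp: is_loop_def)
  {
    assume "\<exists>\<xi>. is_entrance \<Lambda> \<xi> \<mu>"
    then obtain \<xi> where \<xi>: "\<xi> \<in> Mor \<Lambda>" "rng \<Lambda> \<xi> = src \<Lambda> \<mu>" "deg \<Lambda> \<xi> \<le> deg \<Lambda> \<mu>"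
      "segment \<Lambda> \<mu> 0 (deg \<Lambda> \<xi>) \<noteq> \<xi>"
      by (auto simp: is_entrance_def paths_at_def)
    obtain \<beta> where "\<beta> \<in> vpaths (src \<Lambda> \<xi>) (deg \<Lambda> \<mu> - deg \<Lambda> \<xi>)"
      using vpaths_nonempty[OF src_in_Obj[OF \<xi>(1)]] by blast
    then have \<beta>: "\<beta> \<in> Mor \<Lambda>" "rng \<Lambda> \<beta> = src \<Lambda> \<xi>" "deg \<Lambda> \<beta> = deg \<Lambda> \<mu> - deg \<Lambda> \<xi>"
      unfolding vpaths_iff by auto
    have "cmp \<Lambda> \<xi> \<beta> \<in> vpaths (src \<Lambda> \<mu>) (deg \<Lambda> \<mu>)"
      unfolding vpaths_iff using \<xi> \<beta>
      by (auto simp: cmp_in_Mor rng_cmp deg_cmp vec_eq_iff less_eq_vec_def)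
    moreover have "cmp \<Lambda> \<xi> \<beta> \<noteq> \<mu>"
      using \<xi>(4) segment_prefix[OF \<xi>(1) \<beta>(1) \<beta>(2)[symmetric]] by auto
    ultimately show "vpaths (src \<Lambda> \<mu>) (deg \<Lambda> \<mu>) \<noteq> {\<mu>}" by blast
  next
    assume "vpaths (src \<Lambda> \<mu>) (deg \<Lambda> \<mu>) \<noteq> {\<mu>}"
    moreover have "\<mu> \<in> vpaths (src \<Lambda> \<mu>) (deg \<Lambda> \<mu>)" using \<mu> by (simp add: vpaths_iff)
    ultimately obtain \<xi> where "\<xi> \<in> vpaths (src \<Lambda> \<mu>) (deg \<Lambda> \<mu>)" "\<xi> \<noteq> \<mu>" by blast
    moreover have "segment \<Lambda> \<mu> 0 (deg \<Lambda> \<mu>) = \<mu>"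
      using segment_prefix[of \<mu> "idn \<Lambda> (src \<Lambda> \<mu>)"] \<mu>
      by (simp add: cmp_idn idn_in_Mor rng_idn src_in_Obj)
    ultimately show "\<exists>\<xi>. is_entrance \<Lambda> \<xi> \<mu>"
      by (auto simp: is_entrance_def paths_at_def vpaths_iff)
  }
qed

lemma vpaths_singleton_iff:
  assumes "\<mu> \<in> vpaths v p" "src \<Lambda> \<mu> = v"
  shows "vpaths v p = {\<mu>} \<longleftrightarrow> desc p v = {#v#}"
proof
  assume "vpaths v p = {\<mu>}"
  then show "desc p v = {#v#}" using assms by (simp add: desc_def)
next
  assume d: "desc p v = {#v#}"
  have "v \<in> Obj \<Lambda>" using assms by (auto simp: vpaths_iff src_in_Obj)
  then have "card (vpaths v p) = 1" using size_desc[of v p] d by simp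
  then show "vpaths v p = {\<mu>}" using assms(1) by (metis card_1_singletonE singletonD)
qed

text \<open>\<open>desc p v = {#v#}\<close> encodes a loop at \<open>v\<close> of degree
  \<open>p\<close> without entrance, and a loop is trivial exactly when its degree is 0.\<close>

lemma cond_HL_iff: "cond_HL \<Lambda> \<longleftrightarrow> (\<forall>v\<in>Obj \<Lambda>. \<forall>p. desc p v = {#v#} \<longrightarrow> p = 0)"
proof (intro iffI ballI allI impI)
  fix v p assume HL: "cond_HL \<Lambda>" and v: "v \<in> Obj \<Lambda>" and d: "desc p v = {#v#}"
  then have "v \<in> src \<Lambda> ` vpaths v p" using set_desc[OF v, of p] by force
  then obtain \<mu> where \<mu>: "\<mu> \<in> vpaths v p" "src \<Lambda> \<mu> = v" by auto
  then have l: "is_loop \<Lambda> \<mu>" "deg \<Lambda> \<mu> = p"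
    unfolding is_loop_def vpaths_iff by auto
  have "vpaths v p = {\<mu>}" using vpaths_singleton_iff[OF \<mu>] d by simp
  then have "\<not> (\<exists>\<xi>. is_entrance \<Lambda> \<xi> \<mu>)" using entrance_iff[OF l(1)] l(2) \<mu>(2) by simp
  then have "\<mu> \<in> idn \<Lambda> ` Obj \<Lambda>"
    using HL l(1) unfolding cond_HL_def nontrivial_loop_def by blast
  then show "p = 0" using l(2) deg_idn by auto
next
  assume R: "\<forall>v\<in>Obj \<Lambda>. \<forall>p. desc p v = {#v#} \<longrightarrow> p = 0"
  show "cond_HL \<Lambda>" unfolding cond_HL_def
  proof (intro allI impI)
    fix \<mu> assume "nontrivial_loop \<Lambda> \<mu>"
    then have l: "is_loop \<Lambda> \<mu>" "\<mu> \<in> Mor \<Lambda>" "rng \<Lambda> \<mu> = src \<Lambda> \<mu>" and n: "\<mu> \<notin> idn \<Lambda> ` Obj \<Lambda>"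
      by (auto simp: nontrivial_loop_def is_loop_def)
    then have "deg \<Lambda> \<mu> \<noteq> 0" using deg_0_paths by (auto simp: paths_of_deg_def)
    then have "desc (deg \<Lambda> \<mu>) (src \<Lambda> \<mu>) \<noteq> {#src \<Lambda> \<mu>#}" using R src_in_Obj[OF l(2)] by blast
    then show "\<exists>\<xi>. is_entrance \<Lambda> \<xi> \<mu>"
      using entrance_iff[OF l(1)] vpaths_singleton_iff[of \<mu> "src \<Lambda> \<mu>" "deg \<Lambda> \<mu>"] l
      by (simp add: vpaths_iff)
  qed
qed

lemma cond_HNE_iff:
  "cond_HNE \<Lambda> \<longleftrightarrow> (\<forall>v\<in>Obj \<Lambda>. \<forall>p. v \<in># desc p v \<longrightarrow> desc p v = {#v#})"
proof (intro iffI ballI allI impI)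
  fix v p assume H: "cond_HNE \<Lambda>" and v: "v \<in> Obj \<Lambda>" and d: "v \<in># desc p v"
  then obtain \<mu> where \<mu>: "\<mu> \<in> vpaths v p" "src \<Lambda> \<mu> = v" unfolding set_desc[OF v] by auto
  then have l: "is_loop \<Lambda> \<mu>" "deg \<Lambda> \<mu> = p"
    unfolding is_loop_def vpaths_iff by auto
  then have "vpaths v p = {\<mu>}" using H entrance_iff[OF l(1)] \<mu>(2) unfolding cond_HNE_def by blast
  then show "desc p v = {#v#}" using vpaths_singleton_iff[OF \<mu>] by simp
next
  assume R: "\<forall>v\<in>Obj \<Lambda>. \<forall>p. v \<in># desc p v \<longrightarrow> desc p v = {#v#}"
  show "cond_HNE \<Lambda>" unfolding cond_HNE_def
  proof
    assume "\<exists>\<mu>. is_loop \<Lambda> \<mu> \<and> (\<exists>\<xi>. is_entrance \<Lambda> \<xi> \<mu>)"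
    then obtain \<mu> where l: "is_loop \<Lambda> \<mu>" and e: "\<exists>\<xi>. is_entrance \<Lambda> \<xi> \<mu>" by blast
    let ?v = "src \<Lambda> \<mu>" and ?p = "deg \<Lambda> \<mu>"
    have v: "?v \<in> Obj \<Lambda>" and \<mu>: "\<mu> \<in> vpaths ?v ?p"
      using l by (auto simp: is_loop_def src_in_Obj vpaths_iff)
    then have "?v \<in># desc ?p ?v" by (auto simp: set_desc)
    then have "vpaths ?v ?p = {\<mu>}" using R v vpaths_singleton_iff[OF \<mu>] by blast
    then show False using entrance_iff[OF l] e by simp
  qed
qed

section \<open>Words at a common level\<close>

lemma at_level_words: "set_mset M \<subseteq> Obj \<Lambda> \<Longrightarrow> at_level m M \<in> talented_words \<Lambda>"
  by (auto simp: at_level_def talented_words_def)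

text \<open>One defining relation performs the first unit step; the induction hypothesis, kept
  general in vertex and level, expands each resulting symbol by the rest of the degree.\<close>

lemma talented_eq_desc:
  assumes "v \<in> Obj \<Lambda>"
  shows "talented_eq \<Lambda> {#(v, n)#} (at_level (n + int_tuple p) (desc p v))"
  using assms
proof (induction p arbitrary: v n rule: nat_vec_induct)
  case zero
  then show ?case
    by (auto simp: desc_0 talented_words_def intro!: talented_eq.refl)
next
  case (step p i)
  let ?n = "n + axis i 1"
  have "talented_eq \<Lambda> (at_level ?n M) (at_level (?n + int_tuple p) (evolve p M))"
    if "set_mset M \<subseteq> Obj \<Lambda>" for M
    using that
  proof (induction M)
    case empty
    then show ?case by (auto simp: talented_words_def intro!: talented_eq.refl)
  next
    case (add w M)
    then show ?case
      using talented_eq.add[OF step.IH[of w ?n], of "at_level ?n M"] by simp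
  qed
  from this[OF desc_Obj[OF step.prems, of "axis i 1"]]
  have "talented_eq \<Lambda> (at_level ?n (desc (axis i 1) v))
     (at_level (n + int_tuple (axis i 1 + p)) (desc (axis i 1 + p) v))"
    by (simp add: desc_add[OF step.prems] int_tuple_add int_tuple_axis add.assoc)
  moreover have "talented_eq \<Lambda> {#(v, n)#} (at_level ?n (desc (axis i 1) v))"
    using talented_eq.gen[OF step.prems, of n i]
    by (simp add: desc_altdef at_level_def paths_Int image_mset.compositionality comp_def)
  ultimately show ?case by (rule talented_eq.trans[rotated])
qed

lemma talented_eq_evolve:
  "set_mset M \<subseteq> Obj \<Lambda> \<Longrightarrow> talented_eq \<Lambda> (at_level m M) (at_level (m + int_tuple p) (evolve p M))"
proof (induction M)
  case empty
  then show ?case by (auto simp: talented_words_def intro!: talented_eq.refl)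
next
  case (add w M)
  then show ?case using talented_eq.add[OF talented_eq_desc[of w m p]] by simp
qed

text \<open>Induction on the word: each new symbol and the part already treated are expanded to a
  common upper bound of their levels. The prescribed lower bound \<open>l0\<close> later allows two
  elements to be compared at one level.\<close>

lemma word_at_level:
  assumes "x \<in> talented_words \<Lambda>"
  obtains l M where "l0 \<le> l" "set_mset M \<subseteq> Obj \<Lambda>" "talented_eq \<Lambda> x (at_level l M)"
proof -
  have "\<exists>l M. l0 \<le> l \<and> set_mset M \<subseteq> Obj \<Lambda> \<and> talented_eq \<Lambda> x (at_level l M)"
    using assms
  proof (induction x)
    case empty
    then show ?case
      by (intro exI[of _ l0] exI[of _ "{#}"]) (auto intro: talented_eq.refl)
  next
    case (add vn x)
    obtain v n where vn: "vn = (v, n)" by fastforce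
    have v: "v \<in> Obj \<Lambda>" and "x \<in> talented_words \<Lambda>"
      using add.prems by (auto simp: talented_words_def vn)
    with add.IH obtain l M where l: "l0 \<le> l" "set_mset M \<subseteq> Obj \<Lambda>" "talented_eq \<Lambda> x (at_level l M)"
      by blast
    obtain m where m: "l \<le> m" "n \<le> m" by (rule vec_upper_bound)
    obtain p where p: "m = l + int_tuple p" using m le_obtain_int_tuple by metis
    obtain q where q: "m = n + int_tuple q" using m le_obtain_int_tuple by metis
    have "talented_eq \<Lambda> x (at_level m (evolve p M))"
      using l talented_eq_evolve[of M l p] p talented_eq.trans by metis
    then have "talented_eq \<Lambda> ({#vn#} + x) (at_level m (desc q v) + at_level m (evolve p M))"
      using talented_eq_desc[OF v, of n q] q vn by (intro talented_eq.add) simp_all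
    then show ?case
      using l m desc_Obj[OF v] evolve_Obj[OF l(2)]
      by (intro exI[of _ m] exI[of _ "desc q v + evolve p M"]) auto
  qed
  then show ?thesis using that by blast
qed

text \<open>Expands all symbols to level \<open>m\<close> and then forgets the level. Because of
  truncation in \<open>nat_tuple\<close>, the value is meaningful only when \<open>m\<close> is
  above every level occurring in \<open>x\<close>.\<close>

definition lift :: "int ^ 'k \<Rightarrow> ('v \<times> (int ^ 'k)) multiset \<Rightarrow> 'v multiset" where
  "lift m x = (\<Sum>(v, n)\<in>#x. desc (nat_tuple (m - n)) v)"

lemma lift_at_level: "lift (m + int_tuple p) (at_level m M) = evolve p M"
  by (simp add: lift_def at_level_def evolve_def image_mset.compositionality comp_def)

text \<open>Rule induction. A defining relation is respected from level \<open>n + axis i 1\<close>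
  on, by \<open>desc_add\<close>. Quantifying over all levels above a threshold lets transitivity
  and addition pass to an upper bound of two thresholds.\<close>

lemma talented_eq_lift: "talented_eq \<Lambda> x y \<Longrightarrow> \<exists>m0. \<forall>m\<ge>m0. lift m x = lift m y"
proof (induction rule: talented_eq.induct)
  case (gen v n i)
  have "lift m {#(v, n)#} = lift m (at_level (n + axis i 1) (desc (axis i 1) v))"
    if "m \<ge> n + axis i 1" for m
  proof -
    from that obtain p where p: "m = n + axis i 1 + int_tuple p" by (rule le_obtain_int_tuple)
    then have "m = n + int_tuple (axis i 1 + p)"
      by (simp add: int_tuple_add int_tuple_axis add.assoc)
    then have "lift m {#(v, n)#} = desc (axis i 1 + p) v" by (simp add: lift_def)
    then show ?thesis using p gen by (simp add: lift_at_level desc_add)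
  qed
  moreover have "at_level (n + axis i 1) (desc (axis i 1) v) = {#(src \<Lambda> \<alpha>, n + axis i 1).
          \<alpha> \<in># mset_set (paths_at \<Lambda> v \<inter> paths_of_deg \<Lambda> (axis i 1))#}"
    by (simp add: desc_altdef at_level_def paths_Int image_mset.compositionality comp_def)
  ultimately show ?case by auto
next
  case (trans x y z)
  then obtain m1 m2 where m12: "\<forall>m\<ge>m1. lift m x = lift m y" "\<forall>m\<ge>m2. lift m y = lift m z" by blast
  obtain l where "m1 \<le> l" "m2 \<le> l" by (rule vec_upper_bound)
  then have "\<forall>m\<ge>l. lift m x = lift m z" using m12 by (metis order_trans)
  then show ?case by blast
next
  case (add x y x' y')
  then obtain m1 m2 where m12: "\<forall>m\<ge>m1. lift m x = lift m y" "\<forall>m\<ge>m2. lift m x' = lift m y'" by blast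
  obtain l where "m1 \<le> l" "m2 \<le> l" by (rule vec_upper_bound)
  then have "\<forall>m\<ge>l. lift m (x + x') = lift m (y + y')"
    using m12 by (simp add: lift_def)
  then show ?case by blast
next
  case (sym x y)
  then show ?case by metis
qed auto

text \<open>The word problem, as in a direct limit: elements agree iff their expansions agree at
  some later level. Forward, \<open>lift\<close> is taken at a level above both the threshold and
  \<open>m + int_tuple q\<close>, and \<open>r\<close> is the remaining gap; backward, both words
  are expanded to the same level.\<close>

lemma talented_eq_at_level_iff:
  assumes "set_mset M \<subseteq> Obj \<Lambda>" "set_mset N \<subseteq> Obj \<Lambda>"
  shows "talented_eq \<Lambda> (at_level m M) (at_level (m + int_tuple q) N)
    \<longleftrightarrow> (\<exists>r. evolve (q + r) M = evolve r N)"
proof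
  assume "talented_eq \<Lambda> (at_level m M) (at_level (m + int_tuple q) N)"
  then obtain m0 where
    m0: "\<forall>l\<ge>m0. lift l (at_level m M) = lift l (at_level (m + int_tuple q) N)"
    using talented_eq_lift by blast
  obtain l where l: "m0 \<le> l" "m + int_tuple q \<le> l" by (rule vec_upper_bound)
  obtain r where r: "l = m + int_tuple q + int_tuple r" using l le_obtain_int_tuple by metis
  then have "l = m + int_tuple (q + r)" by (simp add: int_tuple_add add.assoc)
  then have "evolve (q + r) M = evolve r N" using m0 l r by (metis lift_at_level)
  then show "\<exists>r. evolve (q + r) M = evolve r N" ..
next
  assume "\<exists>r. evolve (q + r) M = evolve r N"
  then obtain r where r: "evolve (q + r) M = evolve r N" ..
  have "talented_eq \<Lambda> (at_level m M) (at_level (m + int_tuple q + int_tuple r) (evolve r N))"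
    using talented_eq_evolve[OF assms(1), of m "q + r"] r by (simp add: int_tuple_add add.assoc)
  then show "talented_eq \<Lambda> (at_level m M) (at_level (m + int_tuple q) N)"
    using talented_eq_evolve[OF assms(2)] talented_eq.trans talented_eq.sym by metis
qed

section \<open>Action, zero and order of the talented monoid in terms of expansions\<close>

abbreviation cls :: "int ^ 'k \<Rightarrow> 'v multiset \<Rightarrow> ('v \<times> (int ^ 'k)) multiset set" where
  "cls m M \<equiv> talented_class \<Lambda> (at_level m M)"

lemma carrier_cls:
  "carrier (talented_monoid \<Lambda>) = {cls m M | m M. m \<ge> l0 \<and> set_mset M \<subseteq> Obj \<Lambda>}"
proof (intro equalityI subsetI)
  fix a assume "a \<in> carrier (talented_monoid \<Lambda>)"
  then obtain x where x: "x \<in> talented_words \<Lambda>" "a = talented_class \<Lambda> x"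
    by (auto simp: carrier_talented_monoid)
  obtain l M where "l0 \<le> l" "set_mset M \<subseteq> Obj \<Lambda>" "talented_eq \<Lambda> x (at_level l M)"
    by (rule word_at_level[OF x(1)])
  then show "a \<in> {cls m M | m M. m \<ge> l0 \<and> set_mset M \<subseteq> Obj \<Lambda>}"
    using x talented_class_eq_iff by auto
qed (auto simp: carrier_talented_monoid at_level_words)

lemma cls_in_carrier: "set_mset M \<subseteq> Obj \<Lambda> \<Longrightarrow> cls m M \<in> carrier (talented_monoid \<Lambda>)"
  by (auto simp: carrier_talented_monoid at_level_words)

lemma cls_eq_iff:
  assumes "set_mset M \<subseteq> Obj \<Lambda>" "set_mset N \<subseteq> Obj \<Lambda>"
  shows "cls m M = cls (m + int_tuple q) N \<longleftrightarrow> (\<exists>r. evolve (q + r) M = evolve r N)"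
  using assms by (simp add: talented_class_eq_iff at_level_words talented_eq_at_level_iff)

lemma act_cls: "talented_act q (cls m M) = cls (m + q) M"
  by (simp add: talented_act_class shift_word_at_level)

lemma act_0: "talented_act 0 (cls m M) = cls m M"
  by (simp add: act_cls)

lemma act_add: "talented_act (p + q) (cls m M) = talented_act p (talented_act q (cls m M))"
  by (simp add: act_cls add.left_commute add.commute)

lemma cls_mult:
  assumes "set_mset M \<subseteq> Obj \<Lambda>" "set_mset N \<subseteq> Obj \<Lambda>"
  shows "cls m M \<otimes>\<^bsub>talented_monoid \<Lambda>\<^esub> cls m N = cls m (M + N)"
  using assms by (simp add: talented_mult at_level_words)

lemma cls_evolve: "set_mset M \<subseteq> Obj \<Lambda> \<Longrightarrow> cls m M = cls (m + int_tuple p) (evolve p M)"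
  by (simp add: talented_class_eq_iff at_level_words talented_eq_evolve)

lemma cls_eq_one_iff:
  assumes "set_mset M \<subseteq> Obj \<Lambda>"
  shows "cls m M = \<one>\<^bsub>talented_monoid \<Lambda>\<^esub> \<longleftrightarrow> M = {#}"
proof -
  have "\<one>\<^bsub>talented_monoid \<Lambda>\<^esub> = cls (m + int_tuple 0) {#}" by (simp add: talented_monoid_def)
  then have "cls m M = \<one>\<^bsub>talented_monoid \<Lambda>\<^esub> \<longleftrightarrow> (\<exists>r. evolve (0 + r) M = evolve r {#})"
    using cls_eq_iff[OF assms, of "{#}" m 0] by simp
  then show ?thesis using assms by (simp add: evolve_eq_empty_iff)
qed

lemma act_eq_iff:
  assumes "set_mset M \<subseteq> Obj \<Lambda>"
  shows "talented_act (int_tuple q) (cls m M) = cls m M \<longleftrightarrow> (\<exists>r. evolve (q + r) M = evolve r M)"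
  using cls_eq_iff[OF assms assms, of m q] by (auto simp: act_cls)

text \<open>Taking \<open>m - int_tuple q\<close> as base level turns the negative shift into the
  forward comparison of \<open>cls_eq_iff\<close>.\<close>

lemma act_neg_eq_iff:
  assumes "set_mset M \<subseteq> Obj \<Lambda>"
  shows "talented_act (- int_tuple q) (cls m M) = cls m M \<longleftrightarrow> (\<exists>r. evolve (q + r) M = evolve r M)"
  using cls_eq_iff[OF assms assms, of "m - int_tuple q" q] by (simp add: act_cls)

lemma act_le_iff:
  assumes M: "set_mset M \<subseteq> Obj \<Lambda>"
  shows "alg_le (talented_monoid \<Lambda>) (talented_act (int_tuple q) (cls m M)) (cls m M)
    \<longleftrightarrow> (\<exists>r Z. set_mset Z \<subseteq> Obj \<Lambda> \<and> evolve (q + r) M = evolve r M + Z)"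
proof
  let ?l = "m + int_tuple q"
  assume "alg_le (talented_monoid \<Lambda>) (talented_act (int_tuple q) (cls m M)) (cls m M)"
  then obtain z where z: "z \<in> carrier (talented_monoid \<Lambda>)"
      "cls m M = cls ?l M \<otimes>\<^bsub>talented_monoid \<Lambda>\<^esub> z"
    by (auto simp: alg_le_def act_cls)
  \<comment> \<open>The complement is represented no lower than the shifted element, so that the
    latter can be expanded to level \<open>l\<close> and the two added there.\<close>
  from z(1) obtain l Z where Z: "?l \<le> l" "set_mset Z \<subseteq> Obj \<Lambda>" "z = cls l Z"
    unfolding carrier_cls[of ?l] by blast
  obtain r where r: "l = ?l + int_tuple r" using Z(1) le_obtain_int_tuple by metis
  have "cls m M = cls l (evolve r M + Z)"
    using z(2) Z cls_evolve[OF M, of ?l r] cls_mult[OF evolve_Obj[OF M] Z(2)] r by metis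
  then have "cls m M = cls (m + int_tuple (q + r)) (evolve r M + Z)"
    using r by (simp add: int_tuple_add add.assoc)
  then obtain s where "evolve (q + r + s) M = evolve s (evolve r M + Z)"
    using cls_eq_iff[OF M, of "evolve r M + Z" m "q + r"] Z(2) evolve_Obj[OF M] by auto
  \<comment> \<open>The further expansion by \<open>s\<close> that equality of classes may require
    is absorbed into the witnesses \<open>r + s\<close> and \<open>evolve s Z\<close>.\<close>
  then have "evolve (q + (r + s)) M = evolve (r + s) M + evolve s Z"
    by (simp add: evolve_add[OF M] add.assoc)
  then show "\<exists>r Z. set_mset Z \<subseteq> Obj \<Lambda> \<and> evolve (q + r) M = evolve r M + Z"
    using evolve_Obj[OF Z(2)] by blast
next
  assume "\<exists>r Z. set_mset Z \<subseteq> Obj \<Lambda> \<and> evolve (q + r) M = evolve r M + Z"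
  then obtain r Z where Z: "set_mset Z \<subseteq> Obj \<Lambda>" "evolve (q + r) M = evolve r M + Z" by blast
  let ?l = "m + int_tuple q + int_tuple r"
  have "cls m M = cls ?l (evolve r M + Z)"
    using cls_evolve[OF M, of m "q + r"] Z by (simp add: int_tuple_add add.assoc)
  also have "\<dots> = cls ?l (evolve r M) \<otimes>\<^bsub>talented_monoid \<Lambda>\<^esub> cls ?l Z"
    using cls_mult[OF evolve_Obj[OF M] Z(1)] by simp
  also have "cls ?l (evolve r M) = talented_act (int_tuple q) (cls m M)"
    using cls_evolve[OF M, of "m + int_tuple q" r] by (simp add: act_cls)
  finally show "alg_le (talented_monoid \<Lambda>) (talented_act (int_tuple q) (cls m M)) (cls m M)"
    using cls_in_carrier[OF Z(1)] unfolding alg_le_def by blast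
qed

text \<open>If the classes agreed, expanding by some \<open>r\<close> and cancelling
  \<open>evolve r M\<close> would leave \<open>evolve r Z\<close> empty, although expansion never
  loses symbols.\<close>

lemma act_neq_of_surplus:
  assumes M: "set_mset M \<subseteq> Obj \<Lambda>" and Z: "Z \<noteq> {#}" and e: "evolve q M = M + Z"
  shows "talented_act (int_tuple q) (cls m M) \<noteq> cls m M"
proof
  assume "talented_act (int_tuple q) (cls m M) = cls m M"
  then obtain r where r: "evolve (q + r) M = evolve r M" using act_eq_iff[OF M] by blast
  have "set_mset Z \<subseteq> Obj \<Lambda>" using evolve_Obj[OF M, of q] e by simp
  moreover have "evolve r Z = {#}" using r e by (simp add: evolve_add[OF M])
  ultimately show False using Z evolve_eq_empty_iff by blast
qed

section \<open>Walks with steps of a fixed degree\<close>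

definition walk :: "nat ^ 'k \<Rightarrow> nat \<Rightarrow> (nat \<Rightarrow> 'v) \<Rightarrow> bool" where
  "walk q n c \<longleftrightarrow> (\<forall>i\<le>n. c i \<in> Obj \<Lambda>) \<and> (\<forall>i<n. c (Suc i) \<in># desc q (c i))"

lemma walk_desc:
  assumes "walk q n c" "i + l \<le> n"
  shows "c (i + l) \<in># desc (scale l q) (c i)"
  using assms(2)
proof (induction l)
  case 0
  then show ?case using assms(1) by (simp add: desc_0 walk_def)
next
  case (Suc l)
  have "desc (scale (Suc l) q) (c i) = evolve q (desc (scale l q) (c i))"
    using assms(1) Suc.prems scale_add[of l 1 q] by (simp add: desc_add walk_def)
  moreover have "c (i + Suc l) \<in># desc q (c (i + l))"
    using assms(1) Suc.prems by (simp add: walk_def)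
  ultimately show ?case using Suc by (auto simp: set_evolve)
qed

text \<open>A path of degree \<open>scale n q\<close> factors into \<open>n\<close> paths of degree
  \<open>q\<close>, whose end vertices form the walk.\<close>

lemma walk_exists:
  assumes "v \<in> Obj \<Lambda>" "w \<in># desc (scale n q) v"
  shows "\<exists>c. walk q n c \<and> c n = w"
  using assms(2)
proof (induction n arbitrary: w)
  case 0
  then have "w = v" using assms(1) by (simp add: desc_0)
  then show ?case using assms(1) by (intro exI[of _ "\<lambda>_. v"]) (simp add: walk_def)
next
  case (Suc n)
  have "desc (scale (Suc n) q) v = evolve q (desc (scale n q) v)"
    using assms(1) scale_add[of n 1 q] by (simp add: desc_add)
  then obtain u where u: "u \<in># desc (scale n q) v" "w \<in># desc q u"
    using Suc.prems by (auto simp: set_evolve)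
  obtain c where c: "walk q n c" "c n = u" using Suc.IH[OF u(1)] by blast
  have "w \<in> Obj \<Lambda>" using desc_Obj[OF assms(1)] Suc.prems by blast
  then have "walk q (Suc n) (c(Suc n := w))"
    using c u(2) by (auto simp: walk_def less_Suc_eq le_Suc_eq)
  moreover have "(c(Suc n := w)) (Suc n) = w" by simp
  ultimately show ?case by blast
qed

lemma desc_scale_fixed:
  assumes "v \<in> Obj \<Lambda>" "desc p v = {#v#}"
  shows "desc (scale j p) v = {#v#}"
proof (induction j)
  case (Suc j)
  then show ?case using assms scale_add[of j 1 p] by (simp add: desc_add)
qed (simp add: assms desc_0)

lemma size_desc_mono: "v \<in> Obj \<Lambda> \<Longrightarrow> size (desc p v) \<le> size (desc (p + q) v)"
  by (simp add: desc_add desc_Obj size_evolve_ge)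

lemma size_eq_1_mem: "size M = 1 \<Longrightarrow> w \<in># M \<Longrightarrow> M = {#w#}"
  by (drule size_1_singleton_mset) auto

text \<open>Without entrances, a walk that has met a cycle can never leave it.\<close>

lemma walk_end_periodic:
  assumes HNE: "cond_HNE \<Lambda>" and c: "walk q n c" and ij: "i < j" "j \<le> n" "c i = c j"
  shows "desc (scale (j - i) q) (c n) = {#c n#}"
proof -
  let ?u = "c i" and ?d = "scale (j - i) q" and ?e = "scale (n - i) q"
  have u: "?u \<in> Obj \<Lambda>" using c ij by (simp add: walk_def)
  have "?u \<in># desc ?d ?u" using walk_desc[OF c, of i "j - i"] ij by simp
  then have d: "desc ?d ?u = {#?u#}" using HNE u cond_HNE_iff by blast
  \<comment> \<open>Going round the cycle \<open>n - i\<close> times takes at least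
    \<open>n - i\<close> steps and still yields one symbol, so the shorter expansion by
    \<open>?e\<close> has size at most 1.\<close>
  have "n - i \<le> (n - i) * (j - i)" using ij by simp
  then obtain x where "(n - i) * (j - i) = (n - i) + x" using le_Suc_ex by blast
  then have "scale (n - i) ?d = ?e + scale x q" by (simp only: scale_scale scale_add)
  then have "size (desc ?e ?u) \<le> 1"
    using size_desc_mono[OF u, of ?e "scale x q"] desc_scale_fixed[OF u d, of "n - i"] by simp
  then have "size (desc ?e ?u) = 1" using size_desc_ge[OF u, of ?e] by linarith
  moreover have "c n \<in># desc ?e ?u" using walk_desc[OF c, of i "n - i"] ij by simp
  ultimately have e: "desc ?e ?u = {#c n#}" by (rule size_eq_1_mem)
  \<comment> \<open>Expansions commute, so the period at \<open>?u\<close> is carried along the walk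
    to \<open>c n\<close>.\<close>
  have "desc ?d (c n) = evolve ?d (desc ?e ?u)" using e by simp
  also have "\<dots> = evolve ?e (desc ?d ?u)"
    using desc_add[OF u, of ?e ?d] desc_add[OF u, of ?d ?e] by (metis add.commute)
  also have "\<dots> = {#c n#}" unfolding d using e by simp
  finally show ?thesis .
qed

text \<open>Equal sizes force each vertex of \<open>N\<close> to expand to a single vertex, again in
  \<open>N\<close>. This self-map of a finite set has a repeating orbit, hence a loop without
  entrance whose degree is a nonzero multiple of \<open>p\<close>; (HL) makes that degree 0.\<close>

lemma HL_no_fixed:
  assumes HL: "cond_HL \<Lambda>" and N: "set_mset N \<subseteq> Obj \<Lambda>" "N \<noteq> {#}" and e: "evolve p N = N"
  shows "p = 0"
proof -
  have one: "size (desc p v) = 1" if v: "v \<in># N" for v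
  proof -
    obtain N' where N': "N = add_mset v N'" using multi_member_split[OF v] by blast
    then have "size N' \<le> size (evolve p N')" "1 \<le> size (desc p v)"
      using N(1) size_evolve_ge[of N' p] size_desc_ge[of v p] by simp_all
    moreover have "size (desc p v) + size (evolve p N') = Suc (size N')"
      using arg_cong[OF e, of size] by (simp add: N')
    ultimately show ?thesis by simp
  qed
  have "\<exists>w. w \<in># N \<and> desc p v = {#w#}" if v: "v \<in># N" for v
  proof -
    obtain w where w: "desc p v = {#w#}" using size_1_singleton_mset[OF one[OF v]] by blast
    then have "w \<in># evolve p N" unfolding set_evolve using v by force
    then show ?thesis using w unfolding e by blast
  qed
  then obtain f where f: "\<And>v. v \<in># N \<Longrightarrow> f v \<in># N \<and> desc p v = {#f v#}" by metis
  obtain v where v: "v \<in># N" using N(2) by (rule multiset_nonemptyE)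
  have fN: "(f ^^ i) v \<in># N" for i by (induction i) (use f v in simp_all)
  have step: "desc (scale l p) ((f ^^ i) v) = {#(f ^^ (i + l)) v#}" for i l
  proof (induction l)
    case 0
    then show ?case using fN[of i] N(1) by (simp add: desc_0 subset_iff)
  next
    case (Suc l)
    have "desc (scale (Suc l) p) ((f ^^ i) v) = evolve p (desc (scale l p) ((f ^^ i) v))"
      using fN[of i] N(1) scale_add[of l 1 p] by (simp add: desc_add subset_iff)
    then show ?case using Suc f[OF fN[of "i + l"]] by simp
  qed
  obtain i j where ij: "i < j" "(f ^^ i) v = (f ^^ j) v"
    by (rule sequence_repeats[of "set_mset N" "\<lambda>i. (f ^^ i) v"]) (simp_all add: fN)
  then have "desc (scale (j - i) p) ((f ^^ i) v) = {#(f ^^ i) v#}" using step[of "j - i" i] by simp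
  then have "scale (j - i) p = 0" using HL fN[of i] N(1) cond_HL_iff by blast
  then show ?thesis using ij by (simp add: scale_eq_0_iff)
qed

text \<open>Every vertex of \<open>N\<close> has a predecessor in \<open>N\<close>, so it is the end of a walk inside \<open>N\<close> that is
  long enough to repeat a vertex.\<close>

lemma HNE_no_surplus:
  assumes HNE: "cond_HNE \<Lambda>" and N: "set_mset N \<subseteq> Obj \<Lambda>" and e: "evolve q N = N + Z"
  shows "Z = {#}"
proof -
  have "\<exists>u. u \<in># N \<and> w \<in># desc q u" if "w \<in># N" for w
    using that arg_cong[OF e, of set_mset] by (auto simp: set_evolve)
  then obtain g where g: "\<And>w. w \<in># N \<Longrightarrow> g w \<in># N \<and> w \<in># desc q (g w)" by metis
  have one: "size (desc q w) = 1" if w: "w \<in># N" for w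
  proof -
    let ?n = "card (set_mset N)"
    \<comment> \<open>Predecessors are chosen backwards from \<open>w\<close>, so the index runs
      down and the walk ends at \<open>c ?n = w\<close>.\<close>
    define c where "c i = (g ^^ (?n - i)) w" for i
    have gN: "(g ^^ i) w \<in># N" for i by (induction i) (auto simp: g w)
    have "c (Suc i) \<in># desc q (c i)" if "i < ?n" for i
    proof -
      have "?n - i = Suc (?n - Suc i)" using that by simp
      then have "c i = g (c (Suc i))" by (simp add: c_def)
      then show ?thesis using g gN by (simp add: c_def)
    qed
    then have c: "walk q ?n c" using gN N by (auto simp: walk_def c_def)
    obtain i j where ij: "i < j" "j \<le> ?n" "c i = c j"
      by (rule sequence_repeats[of "set_mset N" c]) (auto simp: c_def gN)
    have w': "w \<in> Obj \<Lambda>" using w N by blast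
    have "desc (scale (j - i) q) w = {#w#}"
      using walk_end_periodic[OF HNE c ij] by (simp add: c_def)
    \<comment> \<open>As \<open>j - i\<close> is at least 1, the period dominates \<open>q\<close>,
      so monotonicity of sizes gives \<open>desc q w\<close> size 1.\<close>
    moreover have "j - i = Suc 0 + (j - i - 1)" using ij by simp
    then have "scale (j - i) q = q + scale (j - i - 1) q" by (metis scale_add scale_simps(2))
    ultimately show ?thesis
      using size_desc_mono[OF w', of q "scale (j - i - 1) q"] size_desc_ge[OF w', of q] by simp
  qed
  have "size (evolve q M) = size M" if "set_mset M \<subseteq> set_mset N" for M
    using that by (induction M) (auto simp: one)
  from this[of N] show ?thesis using e by simp
qed

text \<open>After \<open>card (Obj \<Lambda>)\<close> steps every symbol ends a walk that has
  repeated a vertex, so it is periodic with a period of at most \<open>card (Obj \<Lambda>)\<close>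
  steps. The factorial is a common multiple of all these periods.\<close>

lemma HNE_periodic:
  assumes HNE: "cond_HNE \<Lambda>" and fin: "finite (Obj \<Lambda>)" and M: "set_mset M \<subseteq> Obj \<Lambda>"
  shows "\<exists>n r. n \<noteq> 0 \<and> evolve (scale n q + r) M = evolve r M"
proof -
  let ?n = "card (Obj \<Lambda>)"
  let ?N = "evolve (scale ?n q) M"
  have "desc (scale (fact ?n) q) w = {#w#}" if w: "w \<in># ?N" for w
  proof -
    obtain v where v: "v \<in> Obj \<Lambda>" "w \<in># desc (scale ?n q) v"
      using w M by (auto simp: set_evolve)
    obtain c where c: "walk q ?n c" "c ?n = w" using walk_exists[OF v] by blast
    obtain i j where ij: "i < j" "j \<le> ?n" "c i = c j"
      using c(1) by (auto simp: walk_def intro: sequence_repeats[OF fin, of c])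
    have "desc (scale (j - i) q) w = {#w#}" using walk_end_periodic[OF HNE c(1) ij] c(2) by simp
    moreover have "j - i dvd fact ?n" using ij by (intro dvd_fact) auto
    moreover have "w \<in> Obj \<Lambda>" using desc_Obj v by blast
    ultimately show ?thesis
      using desc_scale_fixed by (metis dvd_div_mult_self scale_scale)
  qed
  then have "evolve (scale (fact ?n) q) ?N = ?N" by (rule evolve_cong_id)
  then have "evolve (scale (fact ?n) q + scale ?n q) M = evolve (scale ?n q) M"
    by (subst add.commute) (simp add: evolve_add[OF M])
  then show ?thesis using fact_nonzero by blast
qed

lemma HNE_failure:
  assumes "\<not> cond_HNE \<Lambda>"
  obtains v p Z where "v \<in> Obj \<Lambda>" "evolve p {#v#} = {#v#} + Z" "Z \<noteq> {#}"
proof -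
  obtain v p where v: "v \<in> Obj \<Lambda>" "v \<in># desc p v" "desc p v \<noteq> {#v#}"
    using assms cond_HNE_iff by blast
  then obtain Z where "desc p v = add_mset v Z" using multi_member_split[OF v(2)] by blast
  then show ?thesis using v that[of v p Z] by simp
qed

section \<open>The three equivalences\<close>

lemma HL_characterisation:
  "cond_HL \<Lambda> \<longleftrightarrow>
    (\<forall>a \<in> carrier (talented_monoid \<Lambda>). a \<noteq> \<one>\<^bsub>talented_monoid \<Lambda>\<^esub> \<longrightarrow>
       (\<forall>n \<in> neg_tuples. talented_act n a \<noteq> a))"
proof (intro iffI ballI impI notI)
  fix a n assume HL: "cond_HL \<Lambda>" and a: "a \<in> carrier (talented_monoid \<Lambda>)"
    "a \<noteq> \<one>\<^bsub>talented_monoid \<Lambda>\<^esub>" and n: "n \<in> neg_tuples" and e: "talented_act n a = a"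
  obtain m M where M: "a = cls m M" "set_mset M \<subseteq> Obj \<Lambda>" using a(1) unfolding carrier_cls[of 0] by blast
  have "n \<le> 0" "n \<noteq> 0" using n by (auto simp: neg_tuples_def)
  then obtain p where p: "0 = n + int_tuple p" using le_obtain_int_tuple by metis
  then have n': "n = - int_tuple p" by (simp add: eq_neg_iff_add_eq_0)
  obtain r where r: "evolve (p + r) M = evolve r M"
    using e act_neg_eq_iff[OF M(2)] M(1) n' by blast
  \<comment> \<open>Equality of classes is visible only after expansion by \<open>r\<close>, so the
    fixed multiset is \<open>evolve r M\<close> rather than \<open>M\<close>.\<close>
  have "evolve p (evolve r M) = evolve r M"
    using r evolve_evolve[OF M(2)] by simp
  moreover have "evolve r M \<noteq> {#}" using a(2) M by (simp add: cls_eq_one_iff evolve_eq_empty_iff)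
  ultimately have "p = 0" using HL_no_fixed[OF HL evolve_Obj[OF M(2)]] by blast
  then show False using n' \<open>n \<noteq> 0\<close> by simp
next
  assume R: "\<forall>a \<in> carrier (talented_monoid \<Lambda>). a \<noteq> \<one>\<^bsub>talented_monoid \<Lambda>\<^esub> \<longrightarrow>
       (\<forall>n \<in> neg_tuples. talented_act n a \<noteq> a)"
  show "cond_HL \<Lambda>" unfolding cond_HL_iff
  proof (intro ballI allI impI, rule ccontr)
    fix v p assume v: "v \<in> Obj \<Lambda>" "desc p v = {#v#}" "p \<noteq> 0"
    have M: "set_mset {#v#} \<subseteq> Obj \<Lambda>" using v by simp
    have "evolve (p + 0) {#v#} = evolve 0 {#v#}" using v by (simp add: desc_0)
    then have "talented_act (- int_tuple p) (cls 0 {#v#}) = cls 0 {#v#}"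
      using act_neg_eq_iff[OF M] by blast
    moreover have "- int_tuple p \<in> neg_tuples"
      using v(3) by (auto simp: neg_tuples_def int_tuple_def less_eq_vec_def vec_eq_iff)
    ultimately show False
      using R cls_in_carrier[OF M] cls_eq_one_iff[OF M] by auto
  qed
qed

text \<open>A strict inequality would be a nonempty surplus of \<open>evolve q\<close> over some
  \<open>evolve r M\<close>, which \<open>HNE_no_surplus\<close> forbids. Conversely, a loop with an
  entrance reproduces its vertex with a surplus, so shifting by its degree strictly decreases the
  class of that vertex.\<close>

lemma HNE_characterisation:
  "cond_HNE \<Lambda> \<longleftrightarrow>
    \<not> (\<exists>a \<in> carrier (talented_monoid \<Lambda>). \<exists>q :: nat ^ 'k.
         alg_less (talented_monoid \<Lambda>) (talented_act (int_tuple q) a) a)"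
proof (intro iffI notI)
  assume HNE: "cond_HNE \<Lambda>" and "\<exists>a \<in> carrier (talented_monoid \<Lambda>). \<exists>q :: nat ^ 'k.
         alg_less (talented_monoid \<Lambda>) (talented_act (int_tuple q) a) a"
  then obtain a q where a: "a \<in> carrier (talented_monoid \<Lambda>)"
    "alg_less (talented_monoid \<Lambda>) (talented_act (int_tuple q) a) a" by blast
  obtain m M where M: "a = cls m M" "set_mset M \<subseteq> Obj \<Lambda>" using a(1) unfolding carrier_cls[of 0] by blast
  obtain r Z where Z: "evolve (q + r) M = evolve r M + Z"
    using a(2) unfolding alg_less_def M(1) act_le_iff[OF M(2)] by blast
  then have "evolve q (evolve r M) = evolve r M + Z"
    using evolve_evolve[OF M(2)] by simp
  then have "Z = {#}" by (rule HNE_no_surplus[OF HNE evolve_Obj[OF M(2)]])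
  then have "evolve (q + r) M = evolve r M" using Z by simp
  then have "talented_act (int_tuple q) a = a" unfolding M(1) act_eq_iff[OF M(2)] ..
  then show False using a(2) by (simp add: alg_less_def)
next
  assume R: "\<not> (\<exists>a \<in> carrier (talented_monoid \<Lambda>). \<exists>q :: nat ^ 'k.
         alg_less (talented_monoid \<Lambda>) (talented_act (int_tuple q) a) a)"
  show "cond_HNE \<Lambda>"
  proof (rule ccontr)
    assume "\<not> cond_HNE \<Lambda>"
    then obtain v p Z where v: "v \<in> Obj \<Lambda>" "evolve p {#v#} = {#v#} + Z" "Z \<noteq> {#}"
      by (rule HNE_failure)
    have M: "set_mset {#v#} \<subseteq> Obj \<Lambda>" using v by simp
    have "evolve (p + 0) {#v#} = evolve 0 {#v#} + Z" "set_mset Z \<subseteq> Obj \<Lambda>"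
      using v evolve_Obj[OF M, of p] by (simp_all add: desc_0)
    then have "alg_le (talented_monoid \<Lambda>) (talented_act (int_tuple p) (cls 0 {#v#})) (cls 0 {#v#})"
      unfolding act_le_iff[OF M] by blast
    then have "alg_less (talented_monoid \<Lambda>) (talented_act (int_tuple p) (cls 0 {#v#})) (cls 0 {#v#})"
      unfolding alg_less_def using act_neq_of_surplus[OF M v(3,2)] by blast
    then show False using R cls_in_carrier[OF M, of 0] by blast
  qed
qed

lemma act_scale_fixed:
  assumes "talented_act (int_tuple p) (cls m M) = cls m M"
  shows "talented_act (int_tuple (scale j p)) (cls m M) = cls m M"
proof (induction j)
  case (Suc j)
  have "talented_act (int_tuple (scale (Suc j) p)) (cls m M)
    = talented_act (int_tuple p) (talented_act (int_tuple (scale j p)) (cls m M))"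
    using scale_add[of 1 j p] by (simp add: int_tuple_add act_add)
  then show ?case using Suc assms by simp
qed (simp add: act_0)

lemma HNE_finite_characterisation:
  assumes fin: "finite (Obj \<Lambda>)"
  shows "cond_HNE \<Lambda> \<longleftrightarrow>
    (\<forall>a \<in> carrier (talented_monoid \<Lambda>). a \<noteq> \<one>\<^bsub>talented_monoid \<Lambda>\<^esub> \<longrightarrow>
       (\<forall>i :: 'k. \<exists>n :: nat. n \<noteq> 0 \<and> talented_act (axis i (int n)) a = a))"
proof (intro iffI ballI impI allI)
  fix a i assume HNE: "cond_HNE \<Lambda>" and a: "a \<in> carrier (talented_monoid \<Lambda>)"
  obtain m M where M: "a = cls m M" "set_mset M \<subseteq> Obj \<Lambda>" using a(1) unfolding carrier_cls[of 0] by blast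
  obtain n r where n: "n \<noteq> 0" "evolve (scale n (axis i 1) + r) M = evolve r M"
    using HNE_periodic[OF HNE fin M(2)] by blast
  then have "talented_act (int_tuple (scale n (axis i 1))) a = a"
    using act_eq_iff[OF M(2)] M(1) by blast
  moreover have "scale n (axis i 1) = axis i n" by (simp add: scale_def vec_eq_iff axis_def)
  ultimately show "\<exists>n. n \<noteq> 0 \<and> talented_act (axis i (int n)) a = a"
    using n(1) by (auto simp: int_tuple_axis)
next
  assume R: "\<forall>a \<in> carrier (talented_monoid \<Lambda>). a \<noteq> \<one>\<^bsub>talented_monoid \<Lambda>\<^esub> \<longrightarrow>
       (\<forall>i :: 'k. \<exists>n :: nat. n \<noteq> 0 \<and> talented_act (axis i (int n)) a = a)"
  show "cond_HNE \<Lambda>"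
  proof (rule ccontr)
    assume "\<not> cond_HNE \<Lambda>"
    then obtain v p Z where v: "v \<in> Obj \<Lambda>" "evolve p {#v#} = {#v#} + Z" "Z \<noteq> {#}"
      by (rule HNE_failure)
    have M: "set_mset {#v#} \<subseteq> Obj \<Lambda>" using v by simp
    let ?a = "cls 0 {#v#}"
    have "\<forall>i. \<exists>n. n \<noteq> 0 \<and> talented_act (axis i (int n)) ?a = ?a"
      using R cls_in_carrier[OF M] cls_eq_one_iff[OF M] by simp
    then obtain n where n: "\<And>i. n i \<noteq> 0" "\<And>i. talented_act (int_tuple (axis i (n i))) ?a = ?a"
      unfolding int_tuple_axis by metis
    \<comment> \<open>A common multiple of the periods in all coordinate directions, so shifting by
      \<open>scale k q\<close> fixes the class for every \<open>q\<close>, in particular for the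
      loop degree \<open>p\<close>.\<close>
    define k where "k = (\<Prod>i\<in>UNIV. n i)"
    have k: "k \<noteq> 0" using n(1) by (simp add: k_def)
    have axis_k: "talented_act (int_tuple (scale k (axis i 1))) ?a = ?a" for i
    proof -
      have "n i dvd k" unfolding k_def by (rule dvd_prodI) auto
      then obtain t where "k = n i * t" by blast
      then have "scale k (axis i 1) = scale t (axis i (n i))"
        by (simp add: scale_def vec_eq_iff axis_def)
      then show ?thesis using act_scale_fixed[OF n(2)] by simp
    qed
    have fix_k: "talented_act (int_tuple (scale k q)) ?a = ?a" for q
    proof (induction q rule: nat_vec_induct)
      case zero
      show ?case using act_0[of 0 "{#v#}"] by simp
    next
      case (step q i)
      have "scale k (axis i 1 + q) = scale k (axis i 1) + scale k q"
        by (simp add: scale_def vec_eq_iff algebra_simps)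
      then have "talented_act (int_tuple (scale k (axis i 1 + q))) ?a
        = talented_act (int_tuple (scale k (axis i 1))) (talented_act (int_tuple (scale k q)) ?a)"
        by (simp only: int_tuple_add act_add)
      then show ?case using step axis_k by simp
    qed
    \<comment> \<open>Going round the loop any positive number of times keeps a surplus. With
      \<open>k = Suc j\<close> this contradicts \<open>fix_k\<close> at \<open>p\<close>.\<close>
    have surplus: "\<exists>Z. Z \<noteq> {#} \<and> evolve (scale (Suc j) p) {#v#} = {#v#} + Z" for j
    proof (induction j)
      case 0
      then show ?case using v by auto
    next
      case (Suc j)
      then obtain Y where Y: "evolve (scale (Suc j) p) {#v#} = {#v#} + Y" by blast
      have "evolve (scale (Suc (Suc j)) p) {#v#} = evolve p {#v#} + evolve p Y"
        using evolve_add[OF M, of "scale (Suc j) p" p] scale_add[of "Suc j" 1 p] Y by simp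
      then show ?case using v by (intro exI[of _ "Z + evolve p Y"]) simp
    qed
    obtain j where "k = Suc j" using k not0_implies_Suc by blast
    then show False using surplus[of j] fix_k[of p] act_neq_of_surplus[OF M] by blast
  qed
qed

end

theorem corollary4p1p5:
  fixes \<Lambda> :: "('v, 'p, 'k::finite) kgraph_data"
  assumes "k_graph \<Lambda>" and "row_finite_no_sources \<Lambda>"
  shows
    "(cond_HL \<Lambda> \<longleftrightarrow>
        (\<forall>a \<in> carrier (talented_monoid \<Lambda>). a \<noteq> \<one>\<^bsub>talented_monoid \<Lambda>\<^esub> \<longrightarrow>
           (\<forall>n \<in> neg_tuples. talented_act n a \<noteq> a)))
     \<and> (cond_HNE \<Lambda> \<longleftrightarrow>
        \<not> (\<exists>a \<in> carrier (talented_monoid \<Lambda>). \<exists>q :: nat ^ 'k.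
             alg_less (talented_monoid \<Lambda>) (talented_act (int_tuple q) a) a))
     \<and> (finite (paths_of_deg \<Lambda> 0) \<longrightarrow>
        (cond_HNE \<Lambda> \<longleftrightarrow>
          (\<forall>a \<in> carrier (talented_monoid \<Lambda>). a \<noteq> \<one>\<^bsub>talented_monoid \<Lambda>\<^esub> \<longrightarrow>
             (\<forall>i :: 'k. \<exists>n :: nat. n \<noteq> 0 \<and> talented_act (axis i (int n)) a = a))))"
proof -
  interpret row_finite_k_graph \<Lambda>
    using assms by (simp add: row_finite_k_graph_def row_finite_k_graph_axioms_def)
  \<comment> \<open>The theorem counts vertices as paths of degree 0; injectivity of
    \<open>idn \<Lambda>\<close> transfers finiteness to the objects.\<close>
  have "finite (paths_of_deg \<Lambda> 0) \<Longrightarrow> finite (Obj \<Lambda>)"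
    using inj_on_idn by (simp add: deg_0_paths finite_image_iff)
  then show ?thesis
    using HL_characterisation HNE_characterisation HNE_finite_characterisation by blast
qed

end
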